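(* Let $m\ge 1$ be an integer, let $a_0,\dots,a_m\in C^\infty([0,1])$ be real-valued, and let $S(x,t)=\sum_{i=0}^m a_i(t)x^i$. Let $a,b$ be two smooth real functions on $[0,1]$ with $a(0)=a(1)$, $b(0)=b(1)$ and $a(t)>0$ for all $t\in[0,1]$. For $\lambda\in\mathbb R$ let $\gamma_\lambda$ be the curve $t\mapsto (t,\lambda a(t)+b(t))$, $t\in[0,1]$, and let $v_S=(1,S(x,t))$ be the vector field induced by the equation $\dot x=S(x,t)$. Assume that $v_S$ is transverse to $m$ curves $\gamma_{\lambda_1},\dots,\gamma_{\lambda_m}$, where $\lambda_1<\cdots<\lambda_m$ are real numbers. If $\{v_S,\dot\gamma_{\lambda_i}\}$ (along $\gamma_{\lambda_i}$) and $\{v_S,\dot\gamma_{\lambda_{i+1}}\}$ (along $\gamma_{\lambda_{i+1}}$) have opposite orientations for each $i=1,\dots,m-1$, then the equation $\dot x=S(x,t)$ has at most $m$ non-zero isolated periodic solutions, counted with multiplicities. This upper bound is sharp, i.e. for every $m\ge1$ there are data $S,a,b,\lambda_1,\dots,\lambda_m$ satisfying the assumptions for which the equation has exactly $m$ non-zero isolated periodic solutions, counted with multiplicities.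
   Context: The equation is $\dot x=\frac{dx}{dt}=S(x,t)$ with $x\in\mathbb R$, $t\in[0,1]$. The dot denotes the derivative in $t$, so $\dot\gamma_\lambda(t)=(1,\lambda\dot a(t)+\dot b(t))$. Transversality of $v_S$ to $\gamma_\lambda$ means that $v_S$ (evaluated at $\gamma_\lambda(t)$, i.e. at $x=\lambda a(t)+b(t)$) and $\dot\gamma_\lambda(t)$ are linearly independent for every $t\in[0,1]$. An ordered pair of planar vectors is positively (resp. negatively) oriented if its determinant is positive (resp. negative). A solution $x(t)$ is called a periodic solution if it is defined on all of $[0,1]$ and $x(0)=x(1)$; it is non-zero if it is not the solution $x(t)\equiv0$. Let $x(t,x_0)$ denote the solution with $x(0,x_0)=x_0$, and let $H(x_0)=x(1,x_0)$ be the return map, defined for those $x_0$ whose solution exists on $[0,1]$. A periodic solution $x(t,x_0)$ is isolated if $x_0$ is an isolated zero of $H(\cdot)-\mathrm{id}$, and its multiplicity is the order of that zero. *)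

theory Defs
  imports "HOL-Analysis.Analysis"
begin

text \<open>
  C-infinity on a set; at the end points of an interval the derivatives are one-sided.
  Values of \<open>f\<close> outside \<open>I\<close> are irrelevant.
\<close>
definition smooth_on :: "real set \<Rightarrow> (real \<Rightarrow> real) \<Rightarrow> bool" where
  "smooth_on I f \<longleftrightarrow>
    (\<exists>D :: nat \<Rightarrow> real \<Rightarrow> real. (\<forall>t\<in>I. D 0 t = f t) \<and>
      (\<forall>n. \<forall>t\<in>I. (D n has_real_derivative D (Suc n) t) (at t within I)))"

definition poly_rhs :: "nat \<Rightarrow> (nat \<Rightarrow> real \<Rightarrow> real) \<Rightarrow> real \<Rightarrow> real \<Rightarrow> real" where
  "poly_rhs m as x t = (\<Sum>i\<le>m. as i t * x ^ i)"


subsection \<open>Curves, orientation and transversality\<close>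

text \<open>Points of the plane are \<open>(t, x)\<close>: the time is component 1, the state component 2.\<close>

definition gamma_curve :: "(real \<Rightarrow> real) \<Rightarrow> (real \<Rightarrow> real) \<Rightarrow> real \<Rightarrow> real \<Rightarrow> real^2" where
  "gamma_curve a b l t = vector [t, l * a t + b t]"

definition induced_field :: "(real \<Rightarrow> real \<Rightarrow> real) \<Rightarrow> real^2 \<Rightarrow> real^2" where
  "induced_field S p = vector [1, S (p $ 2) (p $ 1)]"

definition velocity :: "(real \<Rightarrow> real^2) \<Rightarrow> real \<Rightarrow> real^2" where
  "velocity g t = vector_derivative g (at t within {0..1})"

text \<open>
  Linear independence of the pair \<open>(u, v)\<close>; \<open>u \<noteq> v\<close> is needed because \<open>{u, u}\<close>
  is an independent set whenever \<open>u \<noteq> 0\<close>.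
\<close>
definition transverse_to :: "(real^2 \<Rightarrow> real^2) \<Rightarrow> (real \<Rightarrow> real^2) \<Rightarrow> bool" where
  "transverse_to V g \<longleftrightarrow>
    (\<forall>t\<in>{0..1}. V (g t) \<noteq> velocity g t \<and> independent {V (g t), velocity g t})"

definition positively_oriented_along :: "(real^2 \<Rightarrow> real^2) \<Rightarrow> (real \<Rightarrow> real^2) \<Rightarrow> bool" where
  "positively_oriented_along V g \<longleftrightarrow>
    (\<forall>t\<in>{0..1}. det (vector [V (g t), velocity g t] :: real^2^2) > 0)"

definition negatively_oriented_along :: "(real^2 \<Rightarrow> real^2) \<Rightarrow> (real \<Rightarrow> real^2) \<Rightarrow> bool" where
  "negatively_oriented_along V g \<longleftrightarrow>
    (\<forall>t\<in>{0..1}. det (vector [V (g t), velocity g t] :: real^2^2) < 0)"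

definition opposite_orientations ::
  "(real^2 \<Rightarrow> real^2) \<Rightarrow> (real \<Rightarrow> real^2) \<Rightarrow> (real \<Rightarrow> real^2) \<Rightarrow> bool" where
  "opposite_orientations V g h \<longleftrightarrow>
    positively_oriented_along V g \<and> negatively_oriented_along V h \<or>
    negatively_oriented_along V g \<and> positively_oriented_along V h"

text \<open>
  The standing assumptions on the coefficients \<open>as 0, \<dots>, as m\<close>, the functions \<open>a, b\<close>
  and the parameters \<open>lam 1 < \<dots> < lam m\<close>.
\<close>
definition alternating_transversal_data ::
  "nat \<Rightarrow> (nat \<Rightarrow> real \<Rightarrow> real) \<Rightarrow> (real \<Rightarrow> real) \<Rightarrow> (real \<Rightarrow> real) \<Rightarrow> (nat \<Rightarrow> real) \<Rightarrow> bool" where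
  "alternating_transversal_data m as a b lam \<longleftrightarrow>
    (\<forall>i\<le>m. smooth_on {0..1} (as i)) \<and>
    smooth_on {0..1} a \<and> smooth_on {0..1} b \<and>
    a 0 = a 1 \<and> b 0 = b 1 \<and> (\<forall>t\<in>{0..1}. a t > 0) \<and>
    strict_mono_on {1..m} lam \<and>
    (\<forall>i\<in>{1..m}. transverse_to (induced_field (poly_rhs m as)) (gamma_curve a b (lam i))) \<and>
    (\<forall>i\<in>{1..<m}. opposite_orientations (induced_field (poly_rhs m as))
        (gamma_curve a b (lam i)) (gamma_curve a b (lam (i + 1))))"


subsection \<open>Periodic solutions and their multiplicity\<close>

definition solution :: "(real \<Rightarrow> real \<Rightarrow> real) \<Rightarrow> (real \<Rightarrow> real) \<Rightarrow> bool" where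
  "solution S x \<longleftrightarrow>
    (\<forall>t\<in>{0..1}. (x has_real_derivative S (x t) t) (at t within {0..1}))"

definition return_domain :: "(real \<Rightarrow> real \<Rightarrow> real) \<Rightarrow> real set" where
  "return_domain S = {x0. \<exists>x. solution S x \<and> x 0 = x0}"

text \<open>Only meaningful on \<open>return_domain S\<close>, where uniqueness makes the description proper.\<close>
definition return_map :: "(real \<Rightarrow> real \<Rightarrow> real) \<Rightarrow> real \<Rightarrow> real" where
  "return_map S x0 = (THE y. \<exists>x. solution S x \<and> x 0 = x0 \<and> x 1 = y)"

definition displacement :: "(real \<Rightarrow> real \<Rightarrow> real) \<Rightarrow> real \<Rightarrow> real" where
  "displacement S x0 = return_map S x0 - x0"

definition periodic_solution :: "(real \<Rightarrow> real \<Rightarrow> real) \<Rightarrow> (real \<Rightarrow> real) \<Rightarrow> bool" where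
  "periodic_solution S x \<longleftrightarrow> solution S x \<and> x 0 = x 1"

definition isolated_periodic_solution :: "(real \<Rightarrow> real \<Rightarrow> real) \<Rightarrow> (real \<Rightarrow> real) \<Rightarrow> bool" where
  "isolated_periodic_solution S x \<longleftrightarrow>
    periodic_solution S x \<and>
    x 0 isolated_in {x0 \<in> return_domain S. displacement S x0 = 0}"

text \<open>
  The order of a zero: the least \<open>n\<close> with non-vanishing \<open>n\<close>-th derivative. It is \<open>\<infinity>\<close>
  (the infimum of the empty set) for a flat zero, so that such a zero is never undercounted.
\<close>
definition order_of_zero :: "(real \<Rightarrow> real) \<Rightarrow> real \<Rightarrow> enat" where
  "order_of_zero f z = (INF n \<in> {n. (deriv ^^ n) f z \<noteq> 0}. enat n)"

definition multiplicity_of :: "(real \<Rightarrow> real \<Rightarrow> real) \<Rightarrow> (real \<Rightarrow> real) \<Rightarrow> enat" where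
  "multiplicity_of S x = order_of_zero (displacement S) (x 0)"

text \<open>
  Solutions are functions on \<open>{0..1}\<close>; \<open>extensional\<close> fixes their irrelevant values elsewhere,
  so that each solution is counted once.
\<close>
definition nonzero_isolated_periodic_solutions ::
  "(real \<Rightarrow> real \<Rightarrow> real) \<Rightarrow> (real \<Rightarrow> real) set" where
  "nonzero_isolated_periodic_solutions S =
    {x \<in> extensional {0..1}. isolated_periodic_solution S x \<and> \<not> (\<forall>t\<in>{0..1}. x t = 0)}"

end

theory Submission
  imports Defs
begin

text \<open>
  In the coordinate \<open>y = (x - b) / a\<close> the equation reads \<open>y' = P(y, t)\<close> with \<open>P\<close> of degree at most
  \<open>m\<close> in \<open>y\<close>, and the curves become the lines \<open>y = lam i\<close>, which periodic solutions never meet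
  because they are crossed in one direction only. With \<open>Q(y) = \<Prod>i. y - lam i\<close>, Lagrange
  interpolation gives \<open>P / Q = c(t) + (\<Sum>i. r_i(t) / (y - lam i))\<close>, and since the signs of both
  \<open>P(lam i, t)\<close> and \<open>Q'(lam i)\<close> alternate, all \<open>r_i(t)\<close> have the same sign. Hence \<open>P / Q\<close> is strictly
  monotone on each of the \<open>m\<close> arcs into which the \<open>lam i\<close> divide the projective line. If \<open>G' = 1 / Q\<close>
  and \<open>y, z\<close> are periodic in the same arc, Rolle's theorem for \<open>G(y) - G(z)\<close> forces \<open>y = z\<close>.
  Likewise, Rolle's theorem for \<open>\<integral> S_x - ln a - ln \<bar>Q(y)\<bar>\<close> shows that the derivative
  \<open>exp (\<integral> S_x)\<close> of the return map at a periodic solution is not \<open>1\<close>, so that all multiplicities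
  are \<open>1\<close>. For sharpness take \<open>S = \<Prod>k. x - (k - 1/2)\<close> and \<open>lam i = i\<close>, \<open>a = 1\<close>, \<open>b = 0\<close>.
\<close>

subsection \<open>Lagrange interpolation\<close>

text \<open>The difference \<open>D\<close> of the two sides vanishes at \<open>card I\<close>
  distinct nodes. Its degree is smaller than that, because the first term matches the coefficient of
  degree \<open>card I\<close>; hence \<open>D = 0\<close>.\<close>

lemma lagrange_form:
  fixes p :: "real poly" and lam :: "'a \<Rightarrow> real"
  assumes fin: "finite I" and inj: "inj_on lam I" and deg: "degree p \<le> card I"
  shows "poly p y = coeff p (card I) * (\<Prod>i\<in>I. y - lam i) +
    (\<Sum>i\<in>I. poly p (lam i) / (\<Prod>j\<in>I - {i}. lam i - lam j) * (\<Prod>j\<in>I - {i}. y - lam j))"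
proof -
  define r where "r i = poly p (lam i) / (\<Prod>j\<in>I - {i}. lam i - lam j)" for i
  define Q where "Q = (\<Prod>i\<in>I. [:- lam i, 1:])"
  define R where "R i = (\<Prod>j\<in>I - {i}. [:- lam j, 1:])" for i
  define c where "c = coeff p (card I)"
  define D where "D = p - smult c Q - (\<Sum>i\<in>I. smult (r i) (R i))"
  have degprod: "degree (\<Prod>i\<in>J. [:- lam i, 1:]) = card J" for J
    by (simp add: degree_prod_eq_sum_degree)
  have lead: "coeff Q (card I) = 1"
    using lead_coeff_prod[of "\<lambda>i. [:- lam i, 1:]" I] by (simp add: Q_def degprod)
  have degR: "degree (R i) < card I" if "i \<in> I" for i
    using that fin by (simp add: R_def degprod card_Diff1_less del: card_Diff_insert)
  have coeffD: "coeff D (card I) = 0"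
    by (simp add: D_def c_def lead coeff_sum coeff_eq_0 degR)
  have "degree D \<le> card I"
    unfolding D_def
    by (intro degree_diff_le degree_sum_le fin deg order_trans[OF degree_smult_le])
       (auto simp: Q_def degprod intro: less_imp_le[OF degR])
  have root: "poly D (lam k) = 0" if "k \<in> I" for k
  proof -
    have Rk: "poly (R i) (lam k) = 0" if "i \<in> I" "i \<noteq> k" for i
      using that \<open>k \<in> I\<close> fin by (auto simp: R_def poly_prod)
    have "(\<Sum>i\<in>I. r i * poly (R i) (lam k)) = r k * poly (R k) (lam k)"
      using \<open>k \<in> I\<close> fin by (subst sum.remove[of _ k]) (auto simp: Rk intro!: sum.neutral)
    also have "\<dots> = poly p (lam k)"
    proof -
      have "(\<Prod>j\<in>I - {k}. lam k - lam j) \<noteq> 0"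
        using fin inj \<open>k \<in> I\<close> by (auto simp: prod_zero_iff inj_on_def)
      thus ?thesis by (simp add: r_def R_def poly_prod)
    qed
    finally have "(\<Sum>i\<in>I. r i * poly (R i) (lam k)) = poly p (lam k)" .
    moreover have "poly Q (lam k) = 0"
      using \<open>k \<in> I\<close> fin by (auto simp: Q_def poly_prod)
    ultimately show ?thesis by (simp add: D_def poly_sum)
  qed
  have "D = 0"
  proof (rule ccontr)
    assume "D \<noteq> 0"
    have "degree D \<noteq> card I"
      using coeffD \<open>D \<noteq> 0\<close> by (metis leading_coeff_0_iff)
    hence "degree D < card I" using \<open>degree D \<le> card I\<close> by simp
    moreover have "card (lam ` I) \<le> card {x. poly D x = 0}"
      using root poly_roots_finite[OF \<open>D \<noteq> 0\<close>] by (intro card_mono) auto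
    moreover have "card (lam ` I) = card I" by (rule card_image[OF inj])
    ultimately show False using card_poly_roots_bound[OF \<open>D \<noteq> 0\<close>] by simp
  qed
  hence "poly D y = 0" by simp
  thus ?thesis by (simp add: D_def Q_def R_def r_def c_def poly_sum poly_prod)
qed

text \<open>This is \<open>lagrange_form\<close> with the nodal polynomial \<open>Q\<close> factored
  out: the bracket is the partial fraction expansion of \<open>p / Q\<close>.\<close>

lemma lagrange_partial_fractions:
  fixes p :: "real poly" and lam :: "'a \<Rightarrow> real"
  assumes fin: "finite I" and inj: "inj_on lam I" and deg: "degree p \<le> card I" and y: "y \<notin> lam ` I"
  shows "poly p y = (\<Prod>i\<in>I. y - lam i) * (coeff p (card I) +
    (\<Sum>i\<in>I. poly p (lam i) / (\<Prod>j\<in>I - {i}. lam i - lam j) / (y - lam i)))"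
proof -
  have "(\<Prod>j\<in>I - {i}. y - lam j) = (\<Prod>i\<in>I. y - lam i) / (y - lam i)" if "i \<in> I" for i
    using that fin y by (subst prod.remove[of I i]) auto
  thus ?thesis
    using lagrange_form[OF fin inj deg, of y]
    by (simp add: distrib_left sum_distrib_left mult.commute)
qed

text \<open>The expansion of \<open>1 / Q\<close>, which later provides an antiderivative of
  \<open>1 / Q\<close> as a combination of logarithms. For \<open>I \<noteq> {}\<close> the constant
  \<open>1\<close> has no coefficient of degree \<open>card I\<close>, so the polynomial part
  disappears.\<close>

lemma lagrange_one:
  fixes lam :: "'a \<Rightarrow> real"
  assumes fin: "finite I" and inj: "inj_on lam I" and ne: "I \<noteq> {}" and y: "y \<notin> lam ` I"
  shows "(\<Sum>i\<in>I. 1 / (\<Prod>j\<in>I - {i}. lam i - lam j) / (y - lam i)) = 1 / (\<Prod>i\<in>I. y - lam i)"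
proof -
  have "coeff (1::real poly) (card I) = 0" using fin ne by (simp add: coeff_eq_0 card_gt_0_iff)
  moreover have "(\<Prod>i\<in>I. y - lam i) \<noteq> 0" using fin y by auto
  ultimately show ?thesis
    using lagrange_partial_fractions[OF fin inj _ y, of 1] by (simp add: field_simps)
qed

text \<open>Product rule for \<open>p = Q * F\<close>: the first sum is the logarithmic derivative
  of \<open>Q\<close>, the second one comes from \<open>F'\<close>. If all residues have one sign,
  then \<open>p' - p * Q' / Q\<close> cannot vanish off the nodes.\<close>

lemma lagrange_pderiv:
  fixes p :: "real poly" and lam :: "'a \<Rightarrow> real"
  assumes fin: "finite I" and inj: "inj_on lam I" and deg: "degree p \<le> card I" and y: "y \<notin> lam ` I"
  shows "poly (pderiv p) y = poly p y * (\<Sum>i\<in>I. 1 / (y - lam i)) -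
    (\<Prod>i\<in>I. y - lam i) * (\<Sum>i\<in>I. poly p (lam i) / (\<Prod>j\<in>I - {i}. lam i - lam j) / (y - lam i)\<^sup>2)"
proof -
  define r where "r i = poly p (lam i) / (\<Prod>j\<in>I - {i}. lam i - lam j)" for i
  define Q where "Q y = (\<Prod>i\<in>I. y - lam i)" for y
  define F where "F y = coeff p (card I) + (\<Sum>i\<in>I. r i / (y - lam i))" for y
  have nz: "y \<noteq> lam i" if "i \<in> I" for i using that y by auto
  have Qnz: "Q y \<noteq> 0" using fin nz by (auto simp: Q_def)
  have dQ: "(Q has_real_derivative Q y * (\<Sum>i\<in>I. 1 / (y - lam i))) (at y)"
    unfolding Q_def
    by (rule has_field_derivative_prod') (use nz in \<open>force intro!: derivative_eq_intros\<close>)+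
  have dF: "(F has_real_derivative - (\<Sum>i\<in>I. r i / (y - lam i)\<^sup>2)) (at y)"
    unfolding F_def
    by (auto intro!: derivative_eq_intros sum.cong simp: nz power2_eq_square simp flip: sum_negf)
  have "((\<lambda>y. Q y * F y) has_real_derivative
      Q y * (\<Sum>i\<in>I. 1 / (y - lam i)) * F y + Q y * - (\<Sum>i\<in>I. r i / (y - lam i)\<^sup>2)) (at y)"
    by (rule derivative_eq_intros dQ dF refl)+ (simp add: algebra_simps)
  \<comment> \<open>Derivatives can be compared only if the factorization holds near
    \<open>y\<close>; the finitely many nodes stay away from \<open>y\<close>.\<close>
  moreover have "eventually (\<lambda>y. poly p y = Q y * F y) (nhds y)"
  proof -
    have "open (- lam ` I)" using fin by (simp add: finite_imp_closed open_Compl)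
    hence "eventually (\<lambda>y. y \<in> - lam ` I) (nhds y)" using y by (intro eventually_nhds_in_open) auto
    thus ?thesis
      by eventually_elim (use lagrange_partial_fractions[OF fin inj deg] in \<open>auto simp: Q_def F_def r_def\<close>)
  qed
  ultimately have "((\<lambda>y. poly p y) has_real_derivative
      Q y * (\<Sum>i\<in>I. 1 / (y - lam i)) * F y + Q y * - (\<Sum>i\<in>I. r i / (y - lam i)\<^sup>2)) (at y)"
    by (subst DERIV_cong_ev) auto
  hence "poly (pderiv p) y = Q y * (\<Sum>i\<in>I. 1 / (y - lam i)) * F y + Q y * - (\<Sum>i\<in>I. r i / (y - lam i)\<^sup>2)"
    by (rule DERIV_unique[OF poly_DERIV])
  moreover have "poly p y = Q y * F y"
    using lagrange_partial_fractions[OF fin inj deg y] by (simp add: Q_def F_def r_def)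
  ultimately show ?thesis by (simp add: Q_def r_def algebra_simps)
qed

subsection \<open>Linear equations on the unit interval\<close>

lemma rolle_within:
  fixes f :: "real \<Rightarrow> real"
  assumes "f 0 = f 1"
    and "\<And>t. t \<in> {0..1} \<Longrightarrow> (f has_real_derivative f' t) (at t within {0..1})"
  shows "\<exists>t\<in>{0..1}. f' t = 0"
proof -
  have "\<exists>t\<in>{0<..<1}. f 1 - f 0 = (\<lambda>u. u * f' t) (1 - 0)"
    by (rule mvt_simple) (use assms(2) in \<open>auto simp: has_field_derivative_def mult_commute_abs\<close>)
  with assms(1) show ?thesis by auto
qed

lemma linear_ode_integrating_factor:
  fixes z p h :: "real \<Rightarrow> real"
  assumes "continuous_on {0..1} h" "t \<in> {0..1}"
    and "(z has_real_derivative p t + h t * z t) (at t within {0..1})"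
  shows "((\<lambda>t. z t * exp (- integral {0..t} h)) has_real_derivative
           p t * exp (- integral {0..t} h)) (at t within {0..1})"
  by (rule derivative_eq_intros assms(3) integral_has_real_derivative[OF assms(1,2)] refl)+
     (simp add: algebra_simps)

lemma homogeneous_linear_ode:
  fixes z h :: "real \<Rightarrow> real"
  assumes h: "continuous_on {0..1} h"
    and z: "\<And>t. t \<in> {0..1} \<Longrightarrow> (z has_real_derivative h t * z t) (at t within {0..1})"
    and t: "t \<in> {0..1}"
  shows "z t = z 0 * exp (integral {0..t} h)"
proof -
  have "\<exists>c. \<forall>t\<in>{0..1}. z t * exp (- integral {0..t} h) = c"
    by (rule has_field_derivative_zero_constant)
       (use linear_ode_integrating_factor[OF h, of _ z "\<lambda>_. 0"] z in auto)
  then obtain c where c: "\<And>t. t \<in> {0..1} \<Longrightarrow> z t * exp (- integral {0..t} h) = c"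
    by blast
  from c[of 0] c[OF t] show ?thesis by (simp add: exp_minus field_simps)
qed

text \<open>Multiplied by the integrating factor, \<open>z\<close> becomes a strictly increasing
  \<open>v\<close> of the same sign. A sign change of \<open>v\<close> would give \<open>z 0\<close>
  and \<open>z 1\<close> different signs. For \<open>z\<close> the signed distance to a curve, this
  says that a curve crossed in one direction only is never met by a periodic solution.\<close>

lemma periodic_nonzero_pos:
  fixes z p h :: "real \<Rightarrow> real"
  assumes h: "continuous_on {0..1} h"
    and z: "\<And>t. t \<in> {0..1} \<Longrightarrow> (z has_real_derivative p t + h t * z t) (at t within {0..1})"
    and p: "\<And>t. t \<in> {0..1} \<Longrightarrow> p t > 0"
    and per: "z 0 = z 1" and t: "t \<in> {0..1}"
  shows "z t \<noteq> 0"
proof -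
  define v where "v t = z t * exp (- integral {0..t} h)" for t
  have dv: "(v has_real_derivative p t * exp (- integral {0..t} h)) (at t within {0..1})"
    if "t \<in> {0..1}" for t
    unfolding v_def using linear_ode_integrating_factor[OF h that, of z p] z[OF that] by blast
  have less: "v s < v t" if "0 \<le> s" "s < t" "t \<le> 1" for s t
  proof -
    have "(v has_derivative (\<lambda>u. u * (p x * exp (- integral {0..x} h)))) (at x within {s..t})"
      if "x \<in> {s..t}" for x
      using DERIV_subset[OF dv, of x "{s..t}"] that \<open>0 \<le> s\<close> \<open>t \<le> 1\<close>
      by (auto simp: has_field_derivative_def mult_commute_abs)
    hence "\<exists>x\<in>{s<..<t}. v t - v s = (\<lambda>u. u * (p x * exp (- integral {0..x} h))) (t - s)"
      by (intro mvt_simple) (use that in auto)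
    then obtain x where "s < x" "x < t" "v t - v s = (t - s) * (p x * exp (- integral {0..x} h))"
      by auto
    moreover from this have "(t - s) * (p x * exp (- integral {0..x} h)) > 0"
      using that by (intro mult_pos_pos p) auto
    ultimately show ?thesis by linarith
  qed
  have le: "v s \<le> v t" if "0 \<le> s" "s \<le> t" "t \<le> 1" for s t
    using less[of s t] that by (cases "s = t") auto
  have sgn: "(v t > 0 \<longleftrightarrow> z t > 0) \<and> (v t < 0 \<longleftrightarrow> z t < 0)" for t
    by (simp add: v_def zero_less_mult_iff mult_less_0_iff)
  have v0: "v 0 = z 0" by (simp add: v_def)
  show ?thesis
  proof (cases "z 0 \<ge> 0")
    case True
    hence "v 1 > 0" using less[of 0 1] v0 by simp
    hence "v 0 > 0" using sgn per by metis
    hence "v t > 0" using le[of 0 t] t by auto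
    thus ?thesis using sgn by force
  next
    case False
    hence "v 1 < 0" using sgn per by (metis not_le)
    hence "v t < 0" using le[of t 1] t by auto
    thus ?thesis using sgn by force
  qed
qed

lemma nonvanishing_same_sign:
  fixes p :: "real \<Rightarrow> real"
  assumes p: "continuous_on {0..1} p" and nz: "\<And>t. t \<in> {0..1} \<Longrightarrow> p t \<noteq> 0"
    and st: "s \<in> {0..1}" "t \<in> {0..1}"
  shows "p s * p t > 0"
proof (rule ccontr)
  assume "\<not> p s * p t > 0"
  hence *: "p s \<le> 0 \<and> 0 \<le> p t \<or> p t \<le> 0 \<and> 0 \<le> p s"
    by (auto simp: zero_less_mult_iff)
  have "connected (p ` {0..1})" by (intro connected_continuous_image p) simp
  hence "0 \<in> p ` {0..1}"
    using * st connectedD_interval[of "p ` {0..1}" "p s" "p t" 0]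
      connectedD_interval[of "p ` {0..1}" "p t" "p s" 0] by blast
  thus False using nz by auto
qed

text \<open>A nonvanishing continuous \<open>p\<close> has constant sign, and the negative case
  follows from the positive one applied to \<open>- z\<close>.\<close>

lemma periodic_nonzero:
  fixes z p h :: "real \<Rightarrow> real"
  assumes h: "continuous_on {0..1} h" and p: "continuous_on {0..1} p"
    and z: "\<And>t. t \<in> {0..1} \<Longrightarrow> (z has_real_derivative p t + h t * z t) (at t within {0..1})"
    and nz: "\<And>t. t \<in> {0..1} \<Longrightarrow> p t \<noteq> 0"
    and per: "z 0 = z 1" and t: "t \<in> {0..1}"
  shows "z t \<noteq> 0"
proof -
  note same_sign = nonvanishing_same_sign[OF p nz]
  show ?thesis
  proof (cases "p 0 > 0")
    case True
    hence "\<And>t. t \<in> {0..1} \<Longrightarrow> p t > 0" using same_sign[of 0] by (auto simp: zero_less_mult_iff)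
    thus ?thesis using periodic_nonzero_pos[OF h z _ per t] by blast
  next
    case False
    hence neg: "- p t > 0" if "t \<in> {0..1}" for t
      using same_sign[of 0 t] that by (auto simp: zero_less_mult_iff)
    have "((\<lambda>t. - z t) has_real_derivative - p t + h t * - z t) (at t within {0..1})" if "t \<in> {0..1}" for t
      by (rule derivative_eq_intros z[OF that] refl)+ simp
    from periodic_nonzero_pos[OF h this neg _ t] show ?thesis using per by simp
  qed
qed

subsection \<open>Solutions and the return map\<close>

text \<open>The divided difference of the right-hand side in the state variable. Written without
  division it makes sense for \<open>x = z\<close> too, where it is the partial derivative with
  respect to \<open>x\<close>.\<close>

definition poly_dd :: "nat \<Rightarrow> (nat \<Rightarrow> real \<Rightarrow> real) \<Rightarrow> real \<Rightarrow> real \<Rightarrow> real \<Rightarrow> real" where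
  "poly_dd m as t x z = (\<Sum>i\<le>m. as i t * (\<Sum>j<i. z ^ (i - Suc j) * x ^ j))"

lemma poly_rhs_diff: "poly_rhs m as x t - poly_rhs m as z t = poly_dd m as t x z * (x - z)"
proof -
  have "poly_rhs m as x t - poly_rhs m as z t = (\<Sum>i\<le>m. as i t * (x ^ i - z ^ i))"
    by (simp add: poly_rhs_def sum_subtractf right_diff_distrib)
  also have "\<dots> = poly_dd m as t x z * (x - z)"
    by (simp add: power_diff_sumr2 poly_dd_def sum_distrib_left mult_ac)
  finally show ?thesis .
qed

lemma continuous_on_poly_rhs:
  fixes T :: "'a::topological_space set"
  assumes "\<And>i. i \<le> m \<Longrightarrow> continuous_on T (\<lambda>u. as i (\<tau> u))" "continuous_on T f"
  shows "continuous_on T (\<lambda>u. poly_rhs m as (f u) (\<tau> u))"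
  unfolding poly_rhs_def by (intro continuous_intros assms) auto

lemma continuous_on_poly_dd:
  fixes T :: "'a::topological_space set"
  assumes "\<And>i. i \<le> m \<Longrightarrow> continuous_on T (\<lambda>u. as i (\<tau> u))" "continuous_on T f" "continuous_on T g"
  shows "continuous_on T (\<lambda>u. poly_dd m as (\<tau> u) (f u) (g u))"
  unfolding poly_dd_def by (intro continuous_intros assms) auto

lemma solution_continuous: "solution S x \<Longrightarrow> continuous_on {0..1} x"
  unfolding solution_def by (auto intro!: DERIV_continuous_on)

text \<open>The difference of two solutions solves a homogeneous linear equation whose coefficient
  is the divided difference. This yields uniqueness, and also that solutions with different initial
  values never meet.\<close>

lemma solution_difference:
  assumes as: "\<And>i. i \<le> m \<Longrightarrow> continuous_on {0..1} (as i)"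
    and x: "solution (poly_rhs m as) x" and y: "solution (poly_rhs m as) y" and t: "t \<in> {0..1}"
  shows "x t - y t = (x 0 - y 0) * exp (integral {0..t} (\<lambda>s. poly_dd m as s (x s) (y s)))"
proof -
  have "((\<lambda>t. x t - y t) has_real_derivative poly_dd m as s (x s) (y s) * (x s - y s)) (at s within {0..1})"
    if "s \<in> {0..1}" for s
    using x y that by (auto simp: solution_def simp flip: poly_rhs_diff intro!: derivative_intros)
  from homogeneous_linear_ode[OF _ this t] show ?thesis
    by (simp add: continuous_on_poly_dd as solution_continuous[OF x] solution_continuous[OF y])
qed

lemma return_map_eq:
  assumes as: "\<And>i. i \<le> m \<Longrightarrow> continuous_on {0..1} (as i)"
    and x: "solution (poly_rhs m as) x"
  shows "return_map (poly_rhs m as) (x 0) = x 1"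
  unfolding return_map_def
proof (rule the_equality)
  fix y assume "\<exists>z. solution (poly_rhs m as) z \<and> z 0 = x 0 \<and> z 1 = y"
  then obtain z where "solution (poly_rhs m as) z" "z 0 = x 0" "z 1 = y" by blast
  thus "y = x 1" using solution_difference[OF as, where t=1] x by fastforce
qed (use x in blast)

section \<open>Nearby solutions and differentiability of the return map\<close>

lemma exp_lipschitz:
  fixes u v M :: real
  assumes "u \<le> M" "v \<le> M"
  shows "\<bar>exp u - exp v\<bar> \<le> exp M * \<bar>u - v\<bar>"
proof -
  have *: "exp u - exp v \<le> exp M * \<bar>u - v\<bar>" if "u \<le> M" for u v
  proof -
    have "exp u * (1 + (v - u)) \<le> exp u * exp (v - u)"
      by (intro mult_left_mono exp_ge_add_one_self) auto
    hence "exp u - exp v \<le> exp u * (u - v)" by (simp add: algebra_simps flip: exp_add)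
    also have "\<dots> \<le> exp M * \<bar>u - v\<bar>" by (rule order_trans[OF mult_left_mono mult_right_mono]) (use that in auto)
    finally show ?thesis .
  qed
  show ?thesis using *[OF assms(1), of v] *[OF assms(2), of u] by (auto simp: abs_if)
qed

text \<open>
  The fixed-point equation is the integrated form of \<open>d' = h(d, t) d\<close>; in this form smallness of
  \<open>\<delta>\<close> alone makes the operator a contraction on all of \<open>[0, 1]\<close>.
\<close>

lemma small_solution:
  fixes h :: "real \<Rightarrow> real \<Rightarrow> real"
  assumes cont: "\<And>f. \<lbrakk>continuous_on {0..1} f; \<And>t. t \<in> {0..1} \<Longrightarrow> \<bar>f t\<bar> \<le> 1\<rbrakk> \<Longrightarrow>
      continuous_on {0..1} (\<lambda>t. h (f t) t)"
    and bound: "\<And>u t. \<lbrakk>\<bar>u\<bar> \<le> 1; t \<in> {0..1}\<rbrakk> \<Longrightarrow> \<bar>h u t\<bar> \<le> M"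
    and lip: "\<And>u v t. \<lbrakk>\<bar>u\<bar> \<le> 1; \<bar>v\<bar> \<le> 1; t \<in> {0..1}\<rbrakk> \<Longrightarrow> \<bar>h u t - h v t\<bar> \<le> L * \<bar>u - v\<bar>"
    and L: "0 \<le> L" and small: "\<bar>\<delta>\<bar> * exp M \<le> 1" "\<bar>\<delta>\<bar> * (exp M * L) < 1"
  obtains d where "continuous_on {0..1} d" "\<And>t. \<bar>d t\<bar> \<le> \<bar>\<delta>\<bar> * exp M"
    "\<And>t. t \<in> {0..1} \<Longrightarrow> d t = \<delta> * exp (integral {0..t} (\<lambda>s. h (d s) s))"
proof -
  define I where "I f t = integral {0..t} (\<lambda>s. h (f s) s)" for f :: "real \<Rightarrow> real" and t
  \<comment> \<open>The fixed point is sought in the unit ball of the bounded continuous functions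
    on the whole line; \<open>clamp\<close> below extends functions from the unit interval by
    freezing time at its end points.\<close>
  define B where "B = cball (0 :: real \<Rightarrow>\<^sub>C real) 1"
  have B1: "\<bar>apply_bcontfun f t\<bar> \<le> 1" if "f \<in> B" for f t
    using norm_bounded[of f t] that by (auto simp: B_def)
  have M0: "0 \<le> M" using bound[of 0 0] by (simp add: order_trans[OF abs_ge_zero])
  have contB: "continuous_on {0..1} (\<lambda>t. h (apply_bcontfun f t) t)" if "f \<in> B" for f
    by (intro cont) (auto intro: B1 that)
  have I_le: "I f t \<le> M" if "f \<in> B" "t \<in> {0..1}" for f t
  proof -
    have "norm (I f t) \<le> M * (t - 0)"
      unfolding I_def
      by (rule integral_bound)
         (use that in \<open>auto intro!: bound B1 intro: continuous_on_subset[OF contB]\<close>)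
    also have "\<dots> \<le> M * 1" using that M0 by (intro mult_left_mono) auto
    finally show ?thesis by simp
  qed
  have I_diff: "\<bar>I f t - I g t\<bar> \<le> L * dist f g" if "f \<in> B" "g \<in> B" "t \<in> {0..1}" for f g t
  proof -
    have c: "continuous_on {0..t} (\<lambda>s. h (apply_bcontfun f s) s)" if "f \<in> B" for f
      using \<open>t \<in> {0..1}\<close> by (intro continuous_on_subset[OF contB[OF that]]) auto
    have "I f t - I g t =
        integral {0..t} (\<lambda>s. h (apply_bcontfun f s) s - h (apply_bcontfun g s) s)"
      unfolding I_def using that
      by (intro integral_diff[symmetric] integrable_continuous_real c)
    also have "norm \<dots> \<le> (L * dist f g) * (t - 0)"
    proof (rule integral_bound)
      fix s assume s: "s \<in> {0..t}"
      have "norm (h (apply_bcontfun f s) s - h (apply_bcontfun g s) s)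
          \<le> L * \<bar>apply_bcontfun f s - apply_bcontfun g s\<bar>"
        using s that by (simp add: lip B1)
      also have "\<dots> \<le> L * dist f g"
        using dist_bounded[of f s g] L by (intro mult_left_mono) (auto simp: dist_real_def)
      finally show "norm (h (apply_bcontfun f s) s - h (apply_bcontfun g s) s) \<le> L * dist f g" .
    qed (use that in \<open>auto intro!: continuous_on_diff c\<close>)
    also have "\<dots> \<le> (L * dist f g) * 1" using that L by (intro mult_left_mono) auto
    finally show ?thesis by simp
  qed
  have "\<exists>g :: real \<Rightarrow>\<^sub>C real. \<forall>t. apply_bcontfun g t = \<delta> * exp (I f (clamp 0 1 t))" if "f \<in> B" for f
  proof -
    have "continuous_on (cbox 0 1) (\<lambda>t. \<delta> * exp (I f t))"
      unfolding I_def using contB[OF that]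
      by (auto intro!: continuous_intros indefinite_integral_continuous_1 integrable_continuous_real)
    from continuous_on_cbox_bcontfunE[OF this] show ?thesis by metis
  qed
  then obtain T :: "(real \<Rightarrow>\<^sub>C real) \<Rightarrow> (real \<Rightarrow>\<^sub>C real)" where
    T: "\<And>f t. f \<in> B \<Longrightarrow> apply_bcontfun (T f) t = \<delta> * exp (I f (clamp 0 1 t))" by metis
  have clamp01: "clamp 0 1 t \<in> {0..1::real}" for t
    using clamp_in_interval[of 0 1 t] by simp
  have T_le: "\<bar>apply_bcontfun (T f) t\<bar> \<le> \<bar>\<delta>\<bar> * exp M" if "f \<in> B" for f t
    using I_le[OF that clamp01] by (simp add: T that abs_mult mult_left_mono)
  have "\<exists>!f\<in>B. T f = f"
  proof (rule Banach_fix)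
    show "complete B" "B \<noteq> {}" by (auto simp: B_def complete_eq_closed)
    \<comment> \<open>The contraction constant collects \<open>L\<close> from the integral,
      \<open>exp M\<close> from the exponential on values up to \<open>M\<close>, and the outer
      factor \<open>\<delta>\<close>.\<close>
    show "0 \<le> \<bar>\<delta>\<bar> * (exp M * L)" "\<bar>\<delta>\<bar> * (exp M * L) < 1" using L small by auto
    show "T ` B \<subseteq> B"
    proof
      fix g assume "g \<in> T ` B"
      then obtain f where f: "f \<in> B" "g = T f" by blast
      have "norm (T f) \<le> 1"
        by (rule norm_bound) (use T_le[OF f(1)] small(1) in \<open>auto intro: order_trans\<close>)
      thus "g \<in> B" by (simp add: B_def f(2))
    qed
    fix f g assume fg: "f \<in> B" "g \<in> B"
    show "dist (T f) (T g) \<le> \<bar>\<delta>\<bar> * (exp M * L) * dist f g"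
    proof (rule dist_bound)
      fix t
      let ?s = "clamp 0 1 t :: real"
      have "dist (T f t) (T g t) = \<bar>\<delta>\<bar> * \<bar>exp (I f ?s) - exp (I g ?s)\<bar>"
        by (simp add: T fg dist_real_def flip: right_diff_distrib abs_mult)
      also have "\<dots> \<le> \<bar>\<delta>\<bar> * (exp M * \<bar>I f ?s - I g ?s\<bar>)"
        by (intro mult_left_mono exp_lipschitz I_le fg clamp01) auto
      also have "\<dots> \<le> \<bar>\<delta>\<bar> * (exp M * (L * dist f g))"
        by (intro mult_left_mono I_diff fg clamp01) auto
      finally show "dist (T f t) (T g t) \<le> \<bar>\<delta>\<bar> * (exp M * L) * dist f g"
        by (simp add: mult_ac)
    qed
  qed
  then obtain f where f: "f \<in> B" "T f = f" by blast
  show thesis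
  proof (rule that[of "apply_bcontfun f"])
    show "continuous_on {0..1} (apply_bcontfun f)" by simp
    show "\<bar>apply_bcontfun f t\<bar> \<le> \<bar>\<delta>\<bar> * exp M" for t using T_le[OF f(1)] f(2) by simp
    show "apply_bcontfun f t = \<delta> * exp (integral {0..t} (\<lambda>s. h (apply_bcontfun f s) s))"
      if "t \<in> {0..1}" for t
      using T[OF f(1), of t] that by (simp add: f(2) I_def)
  qed
qed

text \<open>Compactness provides the constants required by \<open>small_solution\<close> for
  \<open>h u t = poly_dd m as t (x t + u) (x t)\<close>.\<close>

lemma poly_dd_bounds:
  assumes as: "\<And>i. i \<le> m \<Longrightarrow> continuous_on {0..1} (as i)" and x: "continuous_on {0..1} x"
  obtains L M where "0 \<le> L"
    "\<And>u t. \<lbrakk>\<bar>u\<bar> \<le> 1; t \<in> {0..1}\<rbrakk> \<Longrightarrow> \<bar>poly_dd m as t (x t + u) (x t)\<bar> \<le> M"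
    "\<And>u v t. \<lbrakk>\<bar>u\<bar> \<le> 1; \<bar>v\<bar> \<le> 1; t \<in> {0..1}\<rbrakk> \<Longrightarrow>
       \<bar>poly_dd m as t (x t + u) (x t) - poly_dd m as t (x t + v) (x t)\<bar> \<le> L * \<bar>u - v\<bar>"
proof -
  \<comment> \<open>\<open>K\<close> is a second divided difference; a bound for it is a Lipschitz
    constant in \<open>u\<close>.\<close>
  define K where "K u v t = (\<Sum>i\<le>m. as i t * (\<Sum>j<i. x t ^ (i - Suc j) *
      (\<Sum>k<j. (x t + v) ^ (j - Suc k) * (x t + u) ^ k)))" for u v t
  have eq: "poly_dd m as t (x t + u) (x t) - poly_dd m as t (x t + v) (x t) = K u v t * (u - v)" for u v t
  proof -
    have "poly_dd m as t (x t + u) (x t) - poly_dd m as t (x t + v) (x t) =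
        (\<Sum>i\<le>m. as i t * (\<Sum>j<i. x t ^ (i - Suc j) * ((x t + u) ^ j - (x t + v) ^ j)))"
      by (simp add: poly_dd_def right_diff_distrib sum_subtractf)
    also have "\<dots> = K u v t * (u - v)"
      by (simp add: K_def power_diff_sumr2 sum_distrib_right sum_distrib_left mult_ac)
    finally show ?thesis .
  qed
  let ?D = "{-1..1} \<times> {0..1} :: (real \<times> real) set"
    and ?E = "{-1..1} \<times> {-1..1} \<times> {0..1} :: (real \<times> real \<times> real) set"
  have [continuous_intros]: "continuous_on ?D (\<lambda>u. as i (snd u))" "continuous_on ?E (\<lambda>u. as i (snd (snd u)))"
    if "i \<le> m" for i
    by (rule continuous_on_compose2[OF as[OF that]]; auto intro!: continuous_intros)+
  have [continuous_intros]: "continuous_on ?D (\<lambda>u. x (snd u))" "continuous_on ?E (\<lambda>u. x (snd (snd u)))"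
    by (rule continuous_on_compose2[OF x]; auto intro!: continuous_intros)+
  have "bounded ((\<lambda>p. poly_dd m as (snd p) (x (snd p) + fst p) (x (snd p))) ` ?D)"
    by (intro compact_imp_bounded compact_continuous_image continuous_on_poly_dd continuous_intros compact_Times)
       auto
  then obtain M where M: "\<And>u t. u \<in> {-1..1} \<Longrightarrow> t \<in> {0..1} \<Longrightarrow> \<bar>poly_dd m as t (x t + u) (x t)\<bar> \<le> M"
    by (fastforce simp: bounded_iff)
  have "bounded ((\<lambda>p. K (fst p) (fst (snd p)) (snd (snd p))) ` ?E)"
    unfolding K_def
    by (intro compact_imp_bounded compact_continuous_image continuous_intros compact_Times)
       auto
  then obtain L where L: "\<And>u v t. u \<in> {-1..1} \<Longrightarrow> v \<in> {-1..1} \<Longrightarrow> t \<in> {0..1} \<Longrightarrow> \<bar>K u v t\<bar> \<le> L"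
    by (fastforce simp: bounded_iff)
  show thesis
  proof (rule that)
    show "0 \<le> L" using L[of 0 0 0] by simp
    show "\<bar>poly_dd m as t (x t + u) (x t)\<bar> \<le> M" if "\<bar>u\<bar> \<le> 1" "t \<in> {0..1}" for u t
      using M[of u t] that by (auto simp: abs_le_iff)
    show "\<bar>poly_dd m as t (x t + u) (x t) - poly_dd m as t (x t + v) (x t)\<bar> \<le> L * \<bar>u - v\<bar>"
      if "\<bar>u\<bar> \<le> 1" "\<bar>v\<bar> \<le> 1" "t \<in> {0..1}" for u v t
      unfolding eq abs_mult using L[of u v t] that by (intro mult_right_mono) (auto simp: abs_le_iff)
  qed
qed

text \<open>For small \<open>\<delta>\<close>, \<open>small_solution\<close> yields a solution
  \<open>x + d\<close> on all of the unit interval with \<open>d 0 = \<delta>\<close>. The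
  difference quotient is then exactly the exponential of the integral of \<open>h (d s) s\<close>,
  and replacing \<open>d\<close> by \<open>0\<close> changes it by a multiple of
  \<open>\<bar>\<delta>\<bar>\<close> at most.\<close>

lemma return_map_has_derivative:
  assumes as: "\<And>i. i \<le> m \<Longrightarrow> continuous_on {0..1} (as i)"
    and x: "solution (poly_rhs m as) x"
  shows "(return_map (poly_rhs m as) has_real_derivative
           exp (integral {0..1} (\<lambda>t. poly_dd m as t (x t) (x t)))) (at (x 0))"
proof -
  define h where "h u t = poly_dd m as t (x t + u) (x t)" for u t
  let ?R = "return_map (poly_rhs m as)" and ?D = "exp (integral {0..1} (h 0))"
  have xc: "continuous_on {0..1} x" by (rule solution_continuous[OF x])
  obtain L M where L: "0 \<le> L"
    and M: "\<And>u t. \<lbrakk>\<bar>u\<bar> \<le> 1; t \<in> {0..1}\<rbrakk> \<Longrightarrow> \<bar>h u t\<bar> \<le> M"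
    and lip: "\<And>u v t. \<lbrakk>\<bar>u\<bar> \<le> 1; \<bar>v\<bar> \<le> 1; t \<in> {0..1}\<rbrakk> \<Longrightarrow> \<bar>h u t - h v t\<bar> \<le> L * \<bar>u - v\<bar>"
    by (rule poly_dd_bounds[of m as x, folded h_def]) (blast intro: as xc that)+
  have cont: "continuous_on {0..1} (\<lambda>t. h (f t) t)" if "continuous_on {0..1} f" for f
    unfolding h_def by (intro continuous_on_poly_dd continuous_intros as xc that)
  have est: "\<bar>(?R (x 0 + \<delta>) - ?R (x 0)) / \<delta> - ?D\<bar> \<le> exp M * (L * (\<bar>\<delta>\<bar> * exp M))"
    if small: "\<bar>\<delta>\<bar> * exp M \<le> 1" "\<bar>\<delta>\<bar> * (exp M * L) < 1" and "\<delta> \<noteq> 0" for \<delta>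
  proof -
    obtain d where dc: "continuous_on {0..1} d" and db: "\<And>t. \<bar>d t\<bar> \<le> \<bar>\<delta>\<bar> * exp M"
      and d: "\<And>t. t \<in> {0..1} \<Longrightarrow> d t = \<delta> * exp (integral {0..t} (\<lambda>s. h (d s) s))"
      by (rule small_solution[OF cont M lip L small]) auto
    have db1: "\<bar>d t\<bar> \<le> 1" for t using db small(1) by (rule order_trans)
    have hd: "continuous_on {0..1} (\<lambda>t. h (d t) t)" by (rule cont[OF dc])
    have dd: "(d has_real_derivative h (d t) t * d t) (at t within {0..1})" if t: "t \<in> {0..1}" for t
    proof (rule has_field_derivative_transform_within[OF _ zero_less_one t])
      show "((\<lambda>t. \<delta> * exp (integral {0..t} (\<lambda>s. h (d s) s))) has_real_derivative h (d t) t * d t)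
          (at t within {0..1})"
        by (rule derivative_eq_intros integral_has_real_derivative[OF hd t] refl)+
           (simp add: d[OF t])
    qed (simp add: d)
    \<comment> \<open>By the definition of the divided difference, \<open>d' = h(d, t) d\<close> is
      exactly the equation for a displacement from \<open>x\<close>.\<close>
    have "solution (poly_rhs m as) (\<lambda>t. x t + d t)"
      unfolding solution_def
    proof
      fix t :: real assume t: "t \<in> {0..1}"
      have "poly_rhs m as (x t + d t) t = poly_rhs m as (x t) t + h (d t) t * d t"
        using poly_rhs_diff[of m as "x t + d t" t "x t"] by (simp add: h_def)
      thus "((\<lambda>t. x t + d t) has_real_derivative poly_rhs m as (x t + d t) t) (at t within {0..1})"
        using x dd[OF t] t by (auto simp: solution_def intro!: derivative_intros)
    qed
    from return_map_eq[OF as this] have "?R (x 0 + \<delta>) = x 1 + d 1"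
      using d[of 0] by simp
    hence "(?R (x 0 + \<delta>) - ?R (x 0)) / \<delta> = exp (integral {0..1} (\<lambda>s. h (d s) s))"
      using \<open>\<delta> \<noteq> 0\<close> d[of 1] by (simp add: return_map_eq[OF as x])
    also have "\<bar>\<dots> - ?D\<bar> \<le> exp M * \<bar>integral {0..1} (\<lambda>s. h (d s) s) - integral {0..1} (h 0)\<bar>"
    proof (rule exp_lipschitz)
      show "integral {0..1} (\<lambda>s. h (d s) s) \<le> M"
        using integral_bound[OF _ hd, of M] M db1 by auto
      show "integral {0..1} (h 0) \<le> M"
        using integral_bound[OF _ cont[of "\<lambda>_. 0"], of M] M by auto
    qed
    also have "integral {0..1} (\<lambda>s. h (d s) s) - integral {0..1} (h 0) =
        integral {0..1} (\<lambda>s. h (d s) s - h 0 s)"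
      using hd cont[of "\<lambda>_. 0"] by (intro integral_diff[symmetric] integrable_continuous_real) auto
    also have "\<bar>\<dots>\<bar> \<le> L * (\<bar>\<delta>\<bar> * exp M)"
    proof -
      have "norm (integral {0..1} (\<lambda>s. h (d s) s - h 0 s)) \<le> L * (\<bar>\<delta>\<bar> * exp M) * (1 - 0)"
      proof (rule integral_bound)
        fix s :: real assume s: "s \<in> {0..1}"
        have "\<bar>h (d s) s - h 0 s\<bar> \<le> L * \<bar>d s\<bar>" using lip[of "d s" 0 s] db1 s by simp
        also have "\<dots> \<le> L * (\<bar>\<delta>\<bar> * exp M)" by (intro mult_left_mono db L)
        finally show "norm (h (d s) s - h 0 s) \<le> L * (\<bar>\<delta>\<bar> * exp M)" by simp
      qed (use hd cont[of "\<lambda>_. 0"] in \<open>auto intro!: continuous_intros\<close>)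
      thus ?thesis by simp
    qed
    finally show ?thesis by simp
  qed
  have lim: "((\<lambda>\<delta>. \<bar>\<delta>\<bar> * c) \<longlongrightarrow> 0) (at (0::real))" for c :: real
    by (auto intro!: tendsto_eq_intros)
  have "\<forall>\<^sub>F \<delta> in at 0. norm ((?R (x 0 + \<delta>) - ?R (x 0)) / \<delta> - ?D) \<le> \<bar>\<delta>\<bar> * (exp M * (L * exp M))"
    using order_tendstoD(2)[OF lim[of "exp M"] zero_less_one]
      order_tendstoD(2)[OF lim[of "exp M * L"] zero_less_one] eventually_neq_at_within[of 0]
    by eventually_elim (use est in \<open>simp add: mult_ac\<close>)
  hence "((\<lambda>\<delta>. (?R (x 0 + \<delta>) - ?R (x 0)) / \<delta> - ?D) \<longlongrightarrow> 0) (at 0)"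
    using lim by (rule Lim_null_comparison)
  thus ?thesis
    by (simp add: DERIV_def LIM_zero_iff h_def[abs_def])
qed

subsection \<open>Orientation along the curves\<close>

lemma velocity_gamma_curve:
  assumes a: "(a has_real_derivative a') (at t within {0..1})"
    and b: "(b has_real_derivative b') (at t within {0..1})" and t: "t \<in> {0..1}"
  shows "velocity (gamma_curve a b l) t = vector [1, l * a' + b']"
proof -
  have vec: "vector [u, v] = u *\<^sub>R (axis 1 1 :: real^2) + v *\<^sub>R axis 2 1" for u v :: real
    by (simp add: vec_eq_iff forall_2 axis_def)
  have eq: "gamma_curve a b l = (\<lambda>t. t *\<^sub>R axis 1 1 + (l * a t + b t) *\<^sub>R axis 2 1)"
    by (simp add: gamma_curve_def vec fun_eq_iff)
  have "(gamma_curve a b l has_vector_derivative vector [1, l * a' + b']) (at t within {0..1})"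
    unfolding eq vec
    by (rule derivative_eq_intros a b refl)+ simp
  thus ?thesis
    unfolding velocity_def using t by (intro vector_derivative_within_closed_interval) auto
qed

text \<open>Both vectors have first component \<open>1\<close>, so they are dependent only if they
  coincide.\<close>

lemma transverse_to_gamma_curve_iff:
  assumes a: "\<And>t. t \<in> {0..1} \<Longrightarrow> (a has_real_derivative a' t) (at t within {0..1})"
    and b: "\<And>t. t \<in> {0..1} \<Longrightarrow> (b has_real_derivative b' t) (at t within {0..1})"
  shows "transverse_to (induced_field S) (gamma_curve a b l) \<longleftrightarrow>
    (\<forall>t\<in>{0..1}. S (l * a t + b t) t - (l * a' t + b' t) \<noteq> 0)"
proof -
  have *: "u \<noteq> v \<and> independent {u, v} \<longleftrightarrow> s - c \<noteq> 0"
    if u: "u = vector [1, s]" and v: "v = vector [1, c]" for s c :: real and u v :: "real^2"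
  proof -
    have eq: "u = v \<longleftrightarrow> s = c" by (simp add: u v vec_eq_iff forall_2)
    have "independent {u, v}" if "s \<noteq> c"
    proof -
      have "v \<noteq> 0" by (simp add: v vec_eq_iff forall_2)
      moreover have "u \<notin> span {v}"
      proof
        assume "u \<in> span {v}"
        then obtain k where k: "u = k *\<^sub>R v" by (auto simp: span_singleton)
        have "u $ 1 = k * v $ 1" "u $ 2 = k * v $ 2" by (simp_all add: k)
        thus False using that by (simp add: u v)
      qed
      ultimately show ?thesis using that eq by (simp add: independent_insert)
    qed
    thus ?thesis using eq by auto
  qed
  show ?thesis
    unfolding transverse_to_def
    by (intro ball_cong refl *)
       (simp_all add: velocity_gamma_curve[OF a b] induced_field_def gamma_curve_def)
qed

text \<open>The minus sign comes from the order field, velocity. It affects all curves alike, so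
  products of two determinants do not see it.\<close>

lemma det_gamma_curve:
  assumes a: "(a has_real_derivative a') (at t within {0..1})"
    and b: "(b has_real_derivative b') (at t within {0..1})" and t: "t \<in> {0..1}"
  shows "det (vector [induced_field S (gamma_curve a b l t), velocity (gamma_curve a b l) t] :: real^2^2) =
    - (S (l * a t + b t) t - (l * a' + b'))"
  by (simp add: velocity_gamma_curve[OF a b t] induced_field_def gamma_curve_def det_2)

lemma smooth_on_derivative:
  assumes "smooth_on {0..1} f"
  obtains f' where "continuous_on {0..1} f'"
    "\<And>t. t \<in> {0..1} \<Longrightarrow> (f has_real_derivative f' t) (at t within {0..1})"
proof -
  from assms obtain D where D0: "\<And>t. t \<in> {0..1} \<Longrightarrow> D 0 t = f t"
    and D: "\<And>n t. t \<in> {0..1} \<Longrightarrow> (D n has_real_derivative D (Suc n) t) (at t within {0..1})"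
    unfolding smooth_on_def by blast
  show thesis
  proof
    show "continuous_on {0..1} (D (Suc 0))" by (rule DERIV_continuous_on[OF D])
    show "(f has_real_derivative D (Suc 0) t) (at t within {0..1})" if "t \<in> {0..1}" for t
      using has_field_derivative_transform_within[OF D[OF that, of 0] zero_less_one that] D0 by blast
  qed
qed

section \<open>Simple zeros and signs of products\<close>

lemma order_of_simple_zero:
  assumes "f z = 0" "(f has_real_derivative d) (at z)" "d \<noteq> 0"
  shows "order_of_zero f z = 1"
proof -
  have "(deriv ^^ 1) f z \<noteq> 0" using DERIV_imp_deriv[OF assms(2)] assms(3) by simp
  moreover have "n \<ge> 1" if "(deriv ^^ n) f z \<noteq> 0" for n
    using that assms(1) by (cases n) auto
  ultimately show ?thesis
    unfolding order_of_zero_def one_enat_def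
    by (intro antisym INF_lower INF_greatest) auto
qed

lemma prod_sign:
  fixes f :: "'a \<Rightarrow> real"
  assumes "finite I" "\<And>k. k \<in> I \<Longrightarrow> f k \<noteq> 0"
  shows "(- 1) ^ card {k \<in> I. f k < 0} * (\<Prod>k\<in>I. f k) > 0"
  using assms
proof (induction I rule: finite_induct)
  case (insert k I)
  have "{j \<in> insert k I. f j < 0} = (if f k < 0 then insert k {j \<in> I. f j < 0} else {j \<in> I. f j < 0})"
    by auto
  with insert show ?case
    by (auto simp: zero_less_mult_iff mult_less_0_iff not_less order_le_less)
qed auto

text \<open>Exactly the \<open>m - i\<close> nodes above \<open>lam i\<close> give negative factors.
  The product is the derivative of the nodal polynomial at \<open>lam i\<close>, so these
  derivatives alternate in sign.\<close>

lemma nodal_product_sign: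
  fixes lam :: "nat \<Rightarrow> real"
  assumes lam: "strict_mono_on {1..m} lam" and i: "i \<in> {1..m}"
  shows "(- 1) ^ (m - i) * (\<Prod>j\<in>{1..m} - {i}. lam i - lam j) > 0"
proof -
  have "lam i < lam j \<longleftrightarrow> i < j" if "j \<in> {1..m}" for j
    using strict_mono_on_less[OF lam i that] .
  hence eq: "{j \<in> {1..m} - {i}. lam i - lam j < 0} = {i<..m}"
    using i by auto
  have "(- 1) ^ card {j \<in> {1..m} - {i}. lam i - lam j < 0} * (\<Prod>j\<in>{1..m} - {i}. lam i - lam j) > 0"
    by (rule prod_sign) (use strict_mono_on_imp_inj_on[OF lam] i in \<open>auto dest: inj_onD\<close>)
  thus ?thesis by (simp only: eq card_greaterThanAtMost)
qed

subsection \<open>Periodic solutions between the curves\<close>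

text \<open>The geometric hypotheses in scalar form: with \<open>a'\<close> and \<open>b'\<close> as
  parameters the velocities are explicit, and opposite orientation of neighbouring curves becomes a
  negative product at each time.\<close>

locale alternating_data =
  fixes m :: nat and as :: "nat \<Rightarrow> real \<Rightarrow> real" and a b a' b' :: "real \<Rightarrow> real" and lam :: "nat \<Rightarrow> real"
  assumes m: "m \<ge> 1"
    and as_cont: "\<And>i. i \<le> m \<Longrightarrow> continuous_on {0..1} (as i)"
    and a_deriv: "\<And>t. t \<in> {0..1} \<Longrightarrow> (a has_real_derivative a' t) (at t within {0..1})"
    and b_deriv: "\<And>t. t \<in> {0..1} \<Longrightarrow> (b has_real_derivative b' t) (at t within {0..1})"
    and a'_cont: "continuous_on {0..1} a'" and b'_cont: "continuous_on {0..1} b'"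
    and a_per: "a 0 = a 1" and b_per: "b 0 = b 1"
    and a_pos: "\<And>t. t \<in> {0..1} \<Longrightarrow> a t > 0"
    and lam: "strict_mono_on {1..m} lam"
    and transverse: "\<And>i t. \<lbrakk>i \<in> {1..m}; t \<in> {0..1}\<rbrakk> \<Longrightarrow>
      poly_rhs m as (lam i * a t + b t) t - (lam i * a' t + b' t) \<noteq> 0"
    and alternating: "\<And>i t. \<lbrakk>i \<in> {1..<m}; t \<in> {0..1}\<rbrakk> \<Longrightarrow>
      (poly_rhs m as (lam i * a t + b t) t - (lam i * a' t + b' t)) *
      (poly_rhs m as (lam (Suc i) * a t + b t) t - (lam (Suc i) * a' t + b' t)) < 0"
begin

text \<open>The speed at which the flow crosses the curve; minus the determinant of field and
  velocity.\<close>

definition q :: "nat \<Rightarrow> real \<Rightarrow> real" where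
  "q i t = poly_rhs m as (lam i * a t + b t) t - (lam i * a' t + b' t)"

text \<open>The right-hand side of the equation for \<open>y = (x - b) / a\<close>, kept as a
  polynomial in \<open>y\<close> so that interpolation applies.\<close>

definition P :: "real \<Rightarrow> real poly" where
  "P t = smult (1 / a t) ((\<Sum>i\<le>m. monom (as i t) i) \<circ>\<^sub>p [:b t, a t:] - [:b' t, a' t:])"

text \<open>The residue at \<open>lam i\<close> of \<open>P t\<close> divided by the nodal
  polynomial.\<close>

definition r :: "real \<Rightarrow> nat \<Rightarrow> real" where
  "r t i = poly (P t) (lam i) / (\<Prod>j\<in>{1..m} - {i}. lam i - lam j)"

definition nrm :: "(real \<Rightarrow> real) \<Rightarrow> real \<Rightarrow> real" where
  "nrm x t = (x t - b t) / a t"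

lemma a_cont: "continuous_on {0..1} a" and b_cont: "continuous_on {0..1} b"
  by (rule DERIV_continuous_on[OF a_deriv] DERIV_continuous_on[OF b_deriv]; assumption)+

lemma q_cont: "continuous_on {0..1} (q i)"
  unfolding q_def by (intro continuous_intros continuous_on_poly_rhs as_cont a_cont b_cont a'_cont b'_cont)

lemma inj_lam: "inj_on lam {1..m}"
  using lam by (rule strict_mono_on_imp_inj_on)

lemma poly_P: "poly (P t) y = (poly_rhs m as (y * a t + b t) t - (y * a' t + b' t)) / a t"
  by (simp add: P_def poly_pcompose poly_sum poly_monom poly_rhs_def algebra_simps
      add_divide_distrib diff_divide_distrib)

lemma poly_P_lam: "poly (P t) (lam i) = q i t / a t"
  by (simp add: poly_P q_def)

lemma degree_P: "degree (P t) \<le> m"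
proof -
  have "degree ((\<Sum>i\<le>m. monom (as i t) i) \<circ>\<^sub>p [:b t, a t:]) \<le>
      degree (\<Sum>i\<le>m. monom (as i t) i) * degree [:b t, a t:]"
    by (rule degree_pcompose_le)
  also have "\<dots> \<le> m * 1"
    by (intro mult_le_mono degree_sum_le order_trans[OF degree_monom_le]) auto
  finally show ?thesis
    \<comment> \<open>The subtracted polynomial has degree up to \<open>1\<close>;
      \<open>m \<ge> 1\<close> keeps the total degree within \<open>m\<close>.\<close>
    unfolding P_def using m
    by (intro order_trans[OF degree_smult_le] degree_diff_le) auto
qed

lemma poly_pderiv_P:
  assumes "t \<in> {0..1}"
  shows "poly (pderiv (P t)) y = poly_dd m as t (y * a t + b t) (y * a t + b t) - a' t / a t"
proof -
  \<comment> \<open>On the diagonal the \<open>i\<close> summands inside \<open>poly_dd\<close>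
    coincide, which turns it into the derivative of the polynomial.\<close>
  have "(\<Sum>j<i. x ^ (i - Suc j) * x ^ j) = real i * x ^ (i - 1)" for i and x :: real
    by (simp flip: power_add)
  hence "poly (\<Sum>i\<le>m. pderiv (monom (as i t) i)) x = poly_dd m as t x x" for x
    by (simp add: pderiv_monom poly_sum poly_monom poly_dd_def mult_ac)
  thus ?thesis
    using a_pos[OF assms]
    by (simp add: P_def pderiv_smult pderiv_diff pderiv_pcompose higher_pderiv_sum[of 1, simplified] pderiv_pCons
          poly_pcompose field_simps)
qed

text \<open>The factor \<open>- q 1 t\<close> normalizes the unknown first sign: for
  \<open>i = 1\<close> the product is the square of \<open>q 1 t\<close>, and each further curve
  flips both \<open>q i t\<close> and the power of \<open>- 1\<close>.\<close>

lemma q_sign: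
  assumes t: "t \<in> {0..1}" and i: "i \<in> {1..m}"
  shows "(- 1) ^ i * (- q 1 t) * q i t > 0"
proof -
  have "1 \<le> i" "i \<le> m" using i by auto
  thus ?thesis
  proof (induction i rule: dec_induct)
    case base
    have "q 1 t \<noteq> 0" using transverse[of 1 t] m t by (simp add: q_def)
    thus ?case by (auto simp: zero_less_mult_iff)
  next
    case (step n)
    have "q n t * q (Suc n) t < 0" using alternating[of n t] step t by (simp add: q_def)
    with step show ?case by (auto simp: zero_less_mult_iff mult_less_0_iff not_less)
  qed
qed

text \<open>The alternation of \<open>q i t\<close> and that of the nodal products cancel, since the
  exponents \<open>i\<close> and \<open>m - i\<close> add up to \<open>m\<close>. The witness is
  \<open>s = (- 1) ^ m * (- q 1 t)\<close>.\<close>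

lemma r_sign:
  assumes t: "t \<in> {0..1}"
  obtains s where "\<And>i. i \<in> {1..m} \<Longrightarrow> s * r t i > 0"
proof
  fix i assume i: "i \<in> {1..m}"
  let ?D = "\<Prod>j\<in>{1..m} - {i}. lam i - lam j"
  have D: "(- 1) ^ (m - i) * ?D > 0" by (rule nodal_product_sign[OF lam i])
  have "(- 1) ^ m = (- 1 :: real) ^ i * (- 1) ^ (m - i)" using i by (simp flip: power_add)
  hence "(- 1) ^ m * (- q 1 t) * r t i =
      ((- 1) ^ i * (- q 1 t) * q i t) * ((- 1) ^ (m - i) / ?D) / a t"
    by (simp add: r_def poly_P_lam mult_ac)
  also have "\<dots> > 0"
  proof -
    have "(- 1) ^ (m - i) / ?D > 0"
      using D by (auto simp: zero_less_mult_iff zero_less_divide_iff)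
    thus ?thesis by (rule divide_pos_pos[OF mult_pos_pos[OF q_sign[OF t i]] a_pos[OF t]])
  qed
  finally show "(- 1) ^ m * (- q 1 t) * r t i > 0" .
qed

text \<open>Both Rolle arguments end here: weights of one strict sign cannot cancel against residues
  of one strict sign. Only the sign of \<open>\<epsilon>\<close> matters.\<close>

lemma r_sum_nonzero:
  assumes t: "t \<in> {0..1}" and w: "\<And>i. i \<in> {1..m} \<Longrightarrow> \<epsilon> * w i > 0"
  shows "(\<Sum>i\<in>{1..m}. r t i * w i) \<noteq> 0"
proof -
  obtain s where s: "\<And>i. i \<in> {1..m} \<Longrightarrow> s * r t i > 0" using r_sign[OF t] by blast
  have "(\<Sum>i\<in>{1..m}. (s * r t i) * (\<epsilon> * w i)) > 0"
    using m by (intro sum_pos mult_pos_pos s w) auto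
  also have "(\<Sum>i\<in>{1..m}. (s * r t i) * (\<epsilon> * w i)) = s * \<epsilon> * (\<Sum>i\<in>{1..m}. r t i * w i)"
    by (simp add: sum_distrib_left mult_ac)
  finally show ?thesis by auto
qed

lemma nrm_deriv:
  assumes x: "solution (poly_rhs m as) x" and t: "t \<in> {0..1}"
  shows "(nrm x has_real_derivative poly (P t) (nrm x t)) (at t within {0..1})"
proof -
  have "a t > 0" by (rule a_pos[OF t])
  hence "((poly_rhs m as (x t) t - b' t) * a t - (x t - b t) * a' t) / (a t * a t) = poly (P t) (nrm x t)"
    by (simp add: poly_P nrm_def field_simps)
  moreover have "(x has_real_derivative poly_rhs m as (x t) t) (at t within {0..1})"
    using x t by (simp add: solution_def)
  ultimately show ?thesis
    unfolding nrm_def[abs_def]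
    using \<open>a t > 0\<close> by (auto intro!: derivative_eq_intros a_deriv b_deriv t)
qed

text \<open>The signed distance to the curve solves a linear equation with inhomogeneity
  \<open>q i\<close>, which transversality keeps away from zero, so \<open>periodic_nonzero\<close>
  applies.\<close>

lemma nrm_avoids_lam:
  assumes x: "periodic_solution (poly_rhs m as) x" and i: "i \<in> {1..m}" and t: "t \<in> {0..1}"
  shows "nrm x t \<noteq> lam i"
proof -
  define z where "z t = x t - (lam i * a t + b t)" for t
  have sol: "solution (poly_rhs m as) x" using x by (simp add: periodic_solution_def)
  have "z t \<noteq> 0"
  proof (rule periodic_nonzero[OF _ q_cont[of i] _ _ _ t])
    show "continuous_on {0..1} (\<lambda>t. poly_dd m as t (x t) (lam i * a t + b t))"
      by (intro continuous_on_poly_dd continuous_intros as_cont a_cont b_cont solution_continuous[OF sol])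
    show "(z has_real_derivative q i t + poly_dd m as t (x t) (lam i * a t + b t) * z t) (at t within {0..1})"
      if "t \<in> {0..1}" for t
    proof -
      have "q i t + poly_dd m as t (x t) (lam i * a t + b t) * z t =
          poly_rhs m as (x t) t - (lam i * a' t + b' t)"
        using poly_rhs_diff[of m as "x t" t "lam i * a t + b t"] by (simp add: q_def z_def)
      thus ?thesis
        using sol that a_deriv[OF that] b_deriv[OF that] unfolding z_def[abs_def] solution_def
        by (auto intro!: derivative_eq_intros)
    qed
    show "q i t \<noteq> 0" if "t \<in> {0..1}" for t using transverse[OF i that] by (simp add: q_def)
    show "z 0 = z 1" using x by (simp add: z_def periodic_solution_def a_per b_per)
  qed
  thus ?thesis using a_pos[OF t] by (auto simp: z_def nrm_def field_simps)
qed

lemma nrm_same_side: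
  assumes x: "periodic_solution (poly_rhs m as) x" and i: "i \<in> {1..m}" and t: "t \<in> {0..1}"
  shows "(nrm x 0 - lam i) * (nrm x t - lam i) > 0"
proof (rule nonvanishing_same_sign[where p = "\<lambda>t. nrm x t - lam i"])
  have "continuous_on {0..1} (nrm x)"
    using x by (intro DERIV_continuous_on[OF nrm_deriv]) (auto simp: periodic_solution_def)
  thus "continuous_on {0..1} (\<lambda>t. nrm x t - lam i)" by (intro continuous_intros)
qed (use nrm_avoids_lam[OF x i] t in auto)

lemma nrm_periodic: "periodic_solution (poly_rhs m as) x \<Longrightarrow> nrm x 0 = nrm x 1"
  by (simp add: nrm_def periodic_solution_def a_per b_per)

section \<open>Logarithmic potentials and the two Rolle arguments\<close>

text \<open>Half the logarithm of the square is the logarithm of the absolute value, which spares a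
  distinction of the sides of the curve.\<close>

lemma log_deriv:
  assumes x: "periodic_solution (poly_rhs m as) x" and i: "i \<in> {1..m}" and t: "t \<in> {0..1}"
  shows "((\<lambda>t. ln ((nrm x t - lam i)\<^sup>2) / 2) has_real_derivative
    poly (P t) (nrm x t) / (nrm x t - lam i)) (at t within {0..1})"
proof -
  have "nrm x t - lam i \<noteq> 0" using nrm_avoids_lam[OF x i t] by simp
  moreover have "(nrm x has_real_derivative poly (P t) (nrm x t)) (at t within {0..1})"
    using x t by (intro nrm_deriv) (auto simp: periodic_solution_def)
  ultimately show ?thesis
    by (auto intro!: derivative_eq_intros simp: power2_eq_square divide_simps zero_less_mult_iff)
qed

text \<open>The sum is \<open>G\<close> along the solution, where \<open>G' = 1 / Q\<close> by
  \<open>lagrange_one\<close>. The chain rule gives \<open>P / Q\<close>, which is then expanded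
  into partial fractions.\<close>

lemma log_potential_deriv:
  assumes x: "periodic_solution (poly_rhs m as) x" and t: "t \<in> {0..1}"
  shows "((\<lambda>t. \<Sum>i\<in>{1..m}. 1 / (\<Prod>j\<in>{1..m} - {i}. lam i - lam j) * (ln ((nrm x t - lam i)\<^sup>2) / 2))
    has_real_derivative coeff (P t) m + (\<Sum>i\<in>{1..m}. r t i / (nrm x t - lam i))) (at t within {0..1})"
proof -
  have y: "nrm x t \<notin> lam ` {1..m}" using nrm_avoids_lam[OF x _ t] by blast
  have "(\<Sum>i\<in>{1..m}. 1 / (\<Prod>j\<in>{1..m} - {i}. lam i - lam j) *
        (poly (P t) (nrm x t) / (nrm x t - lam i))) =
      poly (P t) (nrm x t) * (\<Sum>i\<in>{1..m}. 1 / (\<Prod>j\<in>{1..m} - {i}. lam i - lam j) / (nrm x t - lam i))"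
    by (simp add: sum_distrib_left mult_ac)
  also have "\<dots> = poly (P t) (nrm x t) / (\<Prod>i\<in>{1..m}. nrm x t - lam i)"
    using lagrange_one[OF _ inj_lam _ y] m by simp
  also have "\<dots> = coeff (P t) m + (\<Sum>i\<in>{1..m}. r t i / (nrm x t - lam i))"
  proof -
    have "(\<Prod>i\<in>{1..m}. nrm x t - lam i) \<noteq> 0" using y by auto
    thus ?thesis
      using lagrange_partial_fractions[OF _ inj_lam _ y, of "P t"] degree_P[of t]
      by (simp add: r_def)
  qed
  finally show ?thesis
    by (intro DERIV_cong[OF DERIV_sum[OF DERIV_cmult[OF log_deriv[OF x _ t]]]]) auto
qed

text \<open>A positive \<open>\<epsilon>\<close> means that both initial points lie in one interval
  between the nodes; a negative one, that one lies below and the other above every node. Rolle's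
  theorem for the difference of the potentials gives a time of equal \<open>P / Q\<close>, whereas
  that difference is \<open>nrm z t - nrm x t\<close> times a sum with terms of one sign.\<close>

lemma periodic_unique:
  assumes x: "periodic_solution (poly_rhs m as) x" and z: "periodic_solution (poly_rhs m as) z"
    and side: "\<And>i. i \<in> {1..m} \<Longrightarrow> \<epsilon> * ((nrm x 0 - lam i) * (nrm z 0 - lam i)) > 0"
  shows "x 0 = z 0"
proof (rule ccontr)
  assume ne: "x 0 \<noteq> z 0"
  let ?F = "\<lambda>x t. coeff (P t) m + (\<Sum>i\<in>{1..m}. r t i / (nrm x t - lam i))"
  let ?G = "\<lambda>x t. \<Sum>i\<in>{1..m}. 1 / (\<Prod>j\<in>{1..m} - {i}. lam i - lam j) * (ln ((nrm x t - lam i)\<^sup>2) / 2)"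
  have "\<exists>t\<in>{0..1}. ?F x t - ?F z t = 0"
  proof (rule rolle_within)
    show "?G x 0 - ?G z 0 = ?G x 1 - ?G z 1" by (simp only: nrm_periodic[OF x] nrm_periodic[OF z])
    show "((\<lambda>t. ?G x t - ?G z t) has_real_derivative ?F x t - ?F z t) (at t within {0..1})"
      if "t \<in> {0..1}" for t
      by (intro DERIV_diff log_potential_deriv x z that)
  qed
  then obtain t where t: "t \<in> {0..1}" and eq: "?F x t = ?F z t" by auto
  define w where "w i = 1 / ((nrm x t - lam i) * (nrm z t - lam i))" for i
  have "x t - z t = (x 0 - z 0) * exp (integral {0..t} (\<lambda>s. poly_dd m as s (x s) (z s)))"
    using solution_difference[OF as_cont _ _ t] x z by (simp add: periodic_solution_def)
  hence "nrm x t \<noteq> nrm z t" using ne a_pos[OF t] by (auto simp: nrm_def)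
  moreover have "(\<Sum>i\<in>{1..m}. r t i * w i) \<noteq> 0"
  proof (rule r_sum_nonzero[OF t])
    fix i assume i: "i \<in> {1..m}"
    \<comment> \<open>No curve is crossed, so the relative position at time \<open>0\<close>
      persists up to \<open>t\<close>.\<close>
    have "0 < (nrm x 0 - lam i) * (nrm x t - lam i)" "0 < (nrm z 0 - lam i) * (nrm z t - lam i)"
      by (intro nrm_same_side x z i t)+
    with side[OF i] show "\<epsilon> * w i > 0"
      by (auto simp: w_def zero_less_mult_iff zero_less_divide_iff mult_less_0_iff)
  qed
  moreover have "?F x t - ?F z t = (nrm z t - nrm x t) * (\<Sum>i\<in>{1..m}. r t i * w i)"
  proof -
    have "r t i / (nrm x t - lam i) - r t i / (nrm z t - lam i) = (nrm z t - nrm x t) * (r t i * w i)"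
      if "i \<in> {1..m}" for i
      using nrm_avoids_lam[OF x that t] nrm_avoids_lam[OF z that t]
      by (simp add: w_def diff_frac_eq) (simp add: algebra_simps)
    thus ?thesis by (simp add: sum_distrib_left flip: sum_subtractf)
  qed
  ultimately show False using eq by simp
qed

text \<open>The integral is the logarithm of the derivative of the return map. If it were zero,
  \<open>?g\<close> would take equal values at both ends, its other terms being periodic; but
  \<open>?g'\<close> is \<open>P' - P * Q' / Q\<close> along the solution, which
  \<open>lagrange_pderiv\<close> shows to be nonzero.\<close>

lemma variational_integral_nonzero:
  assumes x: "periodic_solution (poly_rhs m as) x"
  shows "integral {0..1} (\<lambda>t. poly_dd m as t (x t) (x t)) \<noteq> 0"
proof
  assume int0: "integral {0..1} (\<lambda>t. poly_dd m as t (x t) (x t)) = 0"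
  have sol: "solution (poly_rhs m as) x" using x by (simp add: periodic_solution_def)
  have cont: "continuous_on {0..1} (\<lambda>t. poly_dd m as t (x t) (x t))"
    by (intro continuous_on_poly_dd as_cont solution_continuous[OF sol])
  let ?g = "\<lambda>t. integral {0..t} (\<lambda>t. poly_dd m as t (x t) (x t)) - ln (a t) -
    (\<Sum>i\<in>{1..m}. ln ((nrm x t - lam i)\<^sup>2) / 2)"
  let ?g' = "\<lambda>t. poly_dd m as t (x t) (x t) - a' t / a t -
    (\<Sum>i\<in>{1..m}. poly (P t) (nrm x t) / (nrm x t - lam i))"
  have "\<exists>t\<in>{0..1}. ?g' t = 0"
  proof (rule rolle_within)
    show "?g 0 = ?g 1" by (simp add: int0 a_per nrm_periodic[OF x])
    show "(?g has_real_derivative ?g' t) (at t within {0..1})" if t: "t \<in> {0..1}" for t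
      using a_pos[OF t]
      by (intro DERIV_diff DERIV_sum log_deriv x t integral_has_real_derivative cont)
         (auto intro!: derivative_eq_intros a_deriv t)
  qed
  then obtain t where t: "t \<in> {0..1}" and eq: "?g' t = 0" by blast
  have y: "nrm x t \<notin> lam ` {1..m}" using nrm_avoids_lam[OF x _ t] by blast
  have "x t = nrm x t * a t + b t" using a_pos[OF t] by (simp add: nrm_def)
  hence "?g' t = poly (pderiv (P t)) (nrm x t) - (\<Sum>i\<in>{1..m}. poly (P t) (nrm x t) / (nrm x t - lam i))"
    using poly_pderiv_P[OF t, of "nrm x t"] by simp
  also have "\<dots> = - (\<Prod>i\<in>{1..m}. nrm x t - lam i) * (\<Sum>i\<in>{1..m}. r t i * (1 / (nrm x t - lam i)\<^sup>2))"
    using lagrange_pderiv[OF _ inj_lam _ y, of "P t"] degree_P[of t]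
    by (simp add: r_def sum_distrib_left sum_negf)
  finally have "(\<Prod>i\<in>{1..m}. nrm x t - lam i) * (\<Sum>i\<in>{1..m}. r t i * (1 / (nrm x t - lam i)\<^sup>2)) = 0"
    using eq by simp
  moreover have "(\<Prod>i\<in>{1..m}. nrm x t - lam i) \<noteq> 0" using y by auto
  moreover have "(\<Sum>i\<in>{1..m}. r t i * (1 / (nrm x t - lam i)\<^sup>2)) \<noteq> 0"
    by (rule r_sum_nonzero[OF t, where \<epsilon> = 1]) (use y in auto)
  ultimately show False by simp
qed

lemma multiplicity_one:
  assumes x: "periodic_solution (poly_rhs m as) x"
  shows "multiplicity_of (poly_rhs m as) x = 1"
  unfolding multiplicity_of_def
proof (rule order_of_simple_zero)
  have sol: "solution (poly_rhs m as) x" using x by (simp add: periodic_solution_def)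
  show "displacement (poly_rhs m as) (x 0) = 0"
    using x return_map_eq[OF as_cont sol] by (simp add: displacement_def periodic_solution_def)
  show "(displacement (poly_rhs m as) has_real_derivative
      exp (integral {0..1} (\<lambda>t. poly_dd m as t (x t) (x t))) - 1) (at (x 0))"
    unfolding displacement_def[abs_def]
    by (intro DERIV_diff DERIV_ident return_map_has_derivative as_cont sol)
  show "exp (integral {0..1} (\<lambda>t. poly_dd m as t (x t) (x t))) - 1 \<noteq> 0"
    using variational_integral_nonzero[OF x] by simp
qed

section \<open>Counting the periodic solutions\<close>

definition periodic_points :: "real set" where
  "periodic_points = {x 0 |x. periodic_solution (poly_rhs m as) x}"

text \<open>The intervals \<open>(-\<infinity>, lam 1)\<close> and \<open>(lam m, \<infinity>)\<close> share one index: they form a single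
  arc of the projective line.\<close>
lemma periodic_points_finite: "finite periodic_points" and card_periodic_points: "card periodic_points \<le> m"
proof -
  \<comment> \<open>\<open>\<kappa>\<close> numbers the \<open>m + 1\<close> intervals between the
    nodes from \<open>0\<close> to \<open>m\<close>; \<open>\<iota>\<close> identifies the two outer
    ones, leaving \<open>m\<close> values.\<close>
  define \<kappa> where "\<kappa> x0 = card {i \<in> {1..m}. lam i < (x0 - b 0) / a 0}" for x0
  define \<iota> where "\<iota> x0 = (if \<kappa> x0 = m then 0 else \<kappa> x0)" for x0
  have le: "\<kappa> x0 \<le> m" for x0
  proof -
    have "\<kappa> x0 \<le> card {1..m}" unfolding \<kappa>_def by (rule card_mono) auto
    thus ?thesis by simp
  qed
  have less: "lam i < (x0 - b 0) / a 0 \<longleftrightarrow> i \<le> \<kappa> x0" if i: "i \<in> {1..m}" for i x0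
  proof -
    let ?A = "{i \<in> {1..m}. lam i < (x0 - b 0) / a 0}"
    show ?thesis
    proof
      assume "lam i < (x0 - b 0) / a 0"
      hence "{1..i} \<subseteq> ?A"
        using i strict_mono_on_leD[OF lam] by fastforce
      hence "card {1..i} \<le> card ?A" by (intro card_mono) auto
      thus "i \<le> \<kappa> x0" by (simp add: \<kappa>_def)
    next
      assume le: "i \<le> \<kappa> x0"
      show "lam i < (x0 - b 0) / a 0"
      proof (rule ccontr)
        assume "\<not> lam i < (x0 - b 0) / a 0"
        hence "?A \<subseteq> {1..<i}"
          using i strict_mono_on_leD[OF lam, of i] by fastforce
        hence "card ?A \<le> card {1..<i}" by (intro card_mono) auto
        hence "\<kappa> x0 \<le> i - 1" by (simp add: \<kappa>_def)
        with le i show False by auto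
      qed
    qed
  qed
  have "inj_on \<iota> periodic_points"
  proof (rule inj_onI)
    fix x0 z0 assume "x0 \<in> periodic_points" "z0 \<in> periodic_points" and eq: "\<iota> x0 = \<iota> z0"
    then obtain x z where x: "periodic_solution (poly_rhs m as) x" "x 0 = x0"
      and z: "periodic_solution (poly_rhs m as) z" "z 0 = z0"
      by (auto simp: periodic_points_def)
    have *: "\<kappa> x0 = \<kappa> z0 \<or> (\<kappa> x0 = 0 \<and> \<kappa> z0 = m) \<or> (\<kappa> x0 = m \<and> \<kappa> z0 = 0)"
      using eq by (auto simp: \<iota>_def split: if_splits)
    have side: "(if \<kappa> x0 = \<kappa> z0 then 1 else - 1) * ((nrm x 0 - lam i) * (nrm z 0 - lam i)) > 0"
      if i: "i \<in> {1..m}" for i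
    proof -
      have "nrm x 0 \<noteq> lam i" "nrm z 0 \<noteq> lam i"
        using nrm_avoids_lam[OF x(1) i, of 0] nrm_avoids_lam[OF z(1) i, of 0] by auto
      moreover have "lam i < nrm x 0 \<longleftrightarrow> i \<le> \<kappa> x0" "lam i < nrm z 0 \<longleftrightarrow> i \<le> \<kappa> z0"
        using less[OF i, of x0] less[OF i, of z0] by (simp_all add: nrm_def x(2) z(2))
      \<comment> \<open>If the indices differ, they are \<open>0\<close> and \<open>m\<close>, so
        every node separates the two points.\<close>
      moreover have "(\<kappa> x0 = \<kappa> z0) \<longleftrightarrow> (i \<le> \<kappa> x0 \<longleftrightarrow> i \<le> \<kappa> z0)"
        using * i by auto
      ultimately show ?thesis
        by (cases "i \<le> \<kappa> x0"; cases "i \<le> \<kappa> z0") (simp_all add: zero_less_mult_iff mult_less_0_iff)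
    qed
    from periodic_unique[OF x(1) z(1) side] show "x0 = z0" by (simp add: x(2) z(2))
  qed
  moreover have "\<iota> ` periodic_points \<subseteq> {0..<m}"
  proof
    fix n assume "n \<in> \<iota> ` periodic_points"
    then obtain x0 where "n = \<iota> x0" by blast
    thus "n \<in> {0..<m}" using le[of x0] m by (simp add: \<iota>_def)
  qed
  ultimately show "finite periodic_points" "card periodic_points \<le> m"
    using inj_on_finite[of \<iota> periodic_points "{0..<m}"] card_inj_on_le[of \<iota> periodic_points "{0..<m}"]
    by auto
qed

text \<open>The zeros of the displacement are the initial values of periodic solutions; this set is
  finite and has no limit point.\<close>

lemma isolated_iff_periodic:
  "isolated_periodic_solution (poly_rhs m as) x \<longleftrightarrow> periodic_solution (poly_rhs m as) x"
proof
  assume x: "periodic_solution (poly_rhs m as) x"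
  let ?Z = "{x0 \<in> return_domain (poly_rhs m as). displacement (poly_rhs m as) x0 = 0}"
  have "?Z = periodic_points"
  proof (intro equalityI subsetI)
    fix x0 assume "x0 \<in> ?Z"
    then obtain z where "solution (poly_rhs m as) z" "z 0 = x0" "displacement (poly_rhs m as) x0 = 0"
      by (auto simp: return_domain_def)
    moreover from this have "return_map (poly_rhs m as) x0 = z 1"
      using return_map_eq[of m as z, OF as_cont] by blast
    ultimately show "x0 \<in> periodic_points"
      by (auto simp: periodic_points_def periodic_solution_def displacement_def)
  next
    fix x0 assume "x0 \<in> periodic_points"
    then obtain z where "solution (poly_rhs m as) z" "z 0 = z 1" "z 0 = x0"
      by (auto simp: periodic_points_def periodic_solution_def)
    moreover from this have "return_map (poly_rhs m as) x0 = z 1"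
      using return_map_eq[of m as z, OF as_cont] by blast
    ultimately show "x0 \<in> ?Z"
      by (auto simp: return_domain_def displacement_def)
  qed
  moreover have "x 0 \<in> periodic_points" using x by (auto simp: periodic_points_def)
  moreover have "\<not> x 0 islimpt periodic_points"
    using periodic_points_finite by (rule islimpt_finite)
  ultimately show "isolated_periodic_solution (poly_rhs m as) x"
    using x by (simp add: isolated_periodic_solution_def isolated_in_islimpt_iff)
qed (simp add: isolated_periodic_solution_def)

lemma nonzero_isolated_inj:
  "inj_on (\<lambda>x. x 0) (nonzero_isolated_periodic_solutions (poly_rhs m as))"
proof (rule inj_onI)
  fix x z assume x: "x \<in> nonzero_isolated_periodic_solutions (poly_rhs m as)"
    and z: "z \<in> nonzero_isolated_periodic_solutions (poly_rhs m as)" and eq: "x 0 = z 0"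
  have "x t = z t" if "t \<in> {0..1}" for t
    using solution_difference[of m as x z, OF as_cont _ _ that] x z eq
    by (simp add: nonzero_isolated_periodic_solutions_def isolated_iff_periodic periodic_solution_def)
  thus "x = z"
    using x z by (intro extensionalityI[of x "{0..1}" z]) (auto simp: nonzero_isolated_periodic_solutions_def)
qed

lemma nonzero_isolated_finite: "finite (nonzero_isolated_periodic_solutions (poly_rhs m as))"
  and nonzero_isolated_card: "card (nonzero_isolated_periodic_solutions (poly_rhs m as)) \<le> m"
proof -
  have sub: "(\<lambda>x. x 0) ` nonzero_isolated_periodic_solutions (poly_rhs m as) \<subseteq> periodic_points"
    by (auto simp: nonzero_isolated_periodic_solutions_def isolated_iff_periodic periodic_points_def)
  show "finite (nonzero_isolated_periodic_solutions (poly_rhs m as))"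
    by (rule inj_on_finite[OF nonzero_isolated_inj sub periodic_points_finite])
  show "card (nonzero_isolated_periodic_solutions (poly_rhs m as)) \<le> m"
    using card_inj_on_le[OF nonzero_isolated_inj sub periodic_points_finite] card_periodic_points by simp
qed

lemma sum_multiplicities:
  "(\<Sum>x \<in> nonzero_isolated_periodic_solutions (poly_rhs m as). multiplicity_of (poly_rhs m as) x) =
    enat (card (nonzero_isolated_periodic_solutions (poly_rhs m as)))"
proof -
  have "(\<Sum>x \<in> nonzero_isolated_periodic_solutions (poly_rhs m as). multiplicity_of (poly_rhs m as) x) =
      (\<Sum>x \<in> nonzero_isolated_periodic_solutions (poly_rhs m as). 1)"
    by (intro sum.cong refl multiplicity_one)
       (simp add: nonzero_isolated_periodic_solutions_def isolated_iff_periodic)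
  thus ?thesis by (simp add: of_nat_eq_enat)
qed

end

section \<open>From the geometric hypotheses to the scalar ones\<close>

lemma alternating_transversal_dataD:
  assumes m: "m \<ge> 1" and data: "alternating_transversal_data m as a b lam"
  shows "\<exists>a' b'. alternating_data m as a b a' b' lam"
proof -
  obtain a' where a'_cont: "continuous_on {0..1} a'"
    and a: "\<And>t. t \<in> {0..1} \<Longrightarrow> (a has_real_derivative a' t) (at t within {0..1})"
    using data smooth_on_derivative[of a] unfolding alternating_transversal_data_def by blast
  obtain b' where b'_cont: "continuous_on {0..1} b'"
    and b: "\<And>t. t \<in> {0..1} \<Longrightarrow> (b has_real_derivative b' t) (at t within {0..1})"
    using data smooth_on_derivative[of b] unfolding alternating_transversal_data_def by blast
  have "alternating_data m as a b a' b' lam"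
  proof
    fix i assume "i \<le> m"
    hence "smooth_on {0..1} (as i)" using data by (simp add: alternating_transversal_data_def)
    thus "continuous_on {0..1} (as i)"
      by (rule smooth_on_derivative) (blast intro: DERIV_continuous_on)
  next
    fix i :: nat and t :: real assume "i \<in> {1..m}" "t \<in> {0..1}"
    thus "poly_rhs m as (lam i * a t + b t) t - (lam i * a' t + b' t) \<noteq> 0"
      using data transverse_to_gamma_curve_iff[OF a b] unfolding alternating_transversal_data_def by blast
  next
    fix i :: nat and t :: real assume i: "i \<in> {1..<m}" and t: "t \<in> {0..1}"
    let ?V = "induced_field (poly_rhs m as)"
    let ?det = "\<lambda>i. det (vector [?V (gamma_curve a b (lam i) t), velocity (gamma_curve a b (lam i)) t] :: real^2^2)"
    have "opposite_orientations ?V (gamma_curve a b (lam i)) (gamma_curve a b (lam (i + 1)))"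
      using data i unfolding alternating_transversal_data_def by blast
    hence "?det i > 0 \<and> ?det (Suc i) < 0 \<or> ?det i < 0 \<and> ?det (Suc i) > 0"
      using t unfolding opposite_orientations_def positively_oriented_along_def
        negatively_oriented_along_def Suc_eq_plus1 by blast
    thus "(poly_rhs m as (lam i * a t + b t) t - (lam i * a' t + b' t)) *
        (poly_rhs m as (lam (Suc i) * a t + b t) t - (lam (Suc i) * a' t + b' t)) < 0"
      unfolding det_gamma_curve[OF a[OF t] b[OF t] t] by (auto simp: mult_less_0_iff)
  qed (use m a b a'_cont b'_cont data in \<open>auto simp: alternating_transversal_data_def\<close>)
  thus ?thesis by blast
qed

subsection \<open>Sharpness\<close>

lemma smooth_on_const: "smooth_on I (\<lambda>_. c)"
  unfolding smooth_on_def
  by (rule exI[of _ "\<lambda>n _. if n = 0 then c else 0"]) auto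

text \<open>The half-integer roots interlace with the nodes \<open>lam i = i\<close>, and none of
  them is zero, so that the corresponding constant solutions all count.\<close>

definition half_nodes :: "nat \<Rightarrow> real poly" where
  "half_nodes m = (\<Prod>k\<in>{1..m}. [:- (real k - 1/2), 1:])"

lemma poly_rhs_half_nodes: "poly_rhs m (\<lambda>i _. coeff (half_nodes m) i) x t = poly (half_nodes m) x"
proof -
  have "degree (half_nodes m) = m" by (simp add: half_nodes_def degree_prod_eq_sum_degree)
  thus ?thesis by (simp add: poly_rhs_def poly_altdef)
qed

lemma half_nodes_sign: "(- 1) ^ (m - i) * poly (half_nodes m) (real i) > 0"
proof -
  have lt: "real i - (real k - 1/2) < 0 \<longleftrightarrow> i < k" for k by linarith
  have "{k \<in> {1..m}. real i - (real k - 1/2) < 0} = {i<..m}" unfolding lt by auto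
  moreover have "real i - (real k - 1/2) \<noteq> 0" for k
  proof
    assume "real i - (real k - 1/2) = 0"
    \<comment> \<open>Doubling turns the equation into one between an even and an odd
      number.\<close>
    hence "real (2 * k) = real (2 * i + 1)" by simp
    thus False unfolding of_nat_eq_iff by presburger
  qed
  ultimately have "(- 1) ^ (m - i) * (\<Prod>k\<in>{1..m}. real i - (real k - 1/2)) > 0"
    using prod_sign[of "{1..m}" "\<lambda>k. real i - (real k - 1/2)"]
    by (metis card_greaterThanAtMost finite_atLeastAtMost)
  thus ?thesis by (simp add: half_nodes_def poly_prod algebra_simps)
qed

lemma half_nodes_data:
  "alternating_transversal_data m (\<lambda>i _. coeff (half_nodes m) i) (\<lambda>_. 1) (\<lambda>_. 0) real"
proof -
  let ?S = "poly_rhs m (\<lambda>i _. coeff (half_nodes m) i)"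
  have d: "((\<lambda>_. 1) has_real_derivative 0) (at t within {0..1})"
    "((\<lambda>_. 0) has_real_derivative 0) (at t within {0..1})" for t :: real by auto
  have nz: "poly (half_nodes m) (real i) \<noteq> 0" for i
    using half_nodes_sign[of m i] by auto
  have "transverse_to (induced_field ?S) (gamma_curve (\<lambda>_. 1) (\<lambda>_. 0) (real i))" if "i \<in> {1..m}" for i
    using nz[of i] that by (subst transverse_to_gamma_curve_iff[OF d]) (simp add: poly_rhs_half_nodes)
  moreover have "opposite_orientations (induced_field ?S) (gamma_curve (\<lambda>_. 1) (\<lambda>_. 0) (real i))
      (gamma_curve (\<lambda>_. 1) (\<lambda>_. 0) (real (i + 1)))" if "i \<in> {1..<m}" for i
  proof -
    \<comment> \<open>The exponents in \<open>half_nodes_sign\<close> for neighbouring nodes differ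
      by one, which gives the alternation.\<close>
    have "m - i = Suc (m - (i + 1))" using that by auto
    hence "poly (half_nodes m) (real i) < 0 \<and> poly (half_nodes m) (real (i + 1)) > 0 \<or>
        poly (half_nodes m) (real i) > 0 \<and> poly (half_nodes m) (real (i + 1)) < 0"
      using half_nodes_sign[of m i] half_nodes_sign[of m "i + 1"] that
      by (auto simp: zero_less_mult_iff mult_less_0_iff)
    thus ?thesis
      by (auto simp: opposite_orientations_def positively_oriented_along_def
          negatively_oriented_along_def det_gamma_curve[OF d] poly_rhs_half_nodes)
  qed
  ultimately show ?thesis
    by (auto simp: alternating_transversal_data_def smooth_on_const strict_mono_on_def)
qed

text \<open>The \<open>m\<close> roots are constant periodic solutions, and the upper bound already
  proved excludes any others. \<open>restrict\<close> makes them extensional.\<close>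

lemma half_nodes_card:
  assumes "m \<ge> 1"
  shows "card (nonzero_isolated_periodic_solutions (poly_rhs m (\<lambda>i _. coeff (half_nodes m) i))) = m"
proof -
  let ?as = "\<lambda>i _. coeff (half_nodes m) i"
  let ?S = "poly_rhs m ?as"
  let ?x = "\<lambda>k::nat. restrict (\<lambda>_. real k - 1/2) {0..1::real}"
  obtain a' b' where "alternating_data m ?as (\<lambda>_. 1) (\<lambda>_. 0) a' b' real"
    using alternating_transversal_dataD[OF assms half_nodes_data] by blast
  then interpret alternating_data m ?as "\<lambda>_. 1" "\<lambda>_. 0" a' b' real .
  have "?x k \<in> nonzero_isolated_periodic_solutions ?S" if k: "k \<in> {1..m}" for k
  proof -
    have root: "poly (half_nodes m) (real k - 1/2) = 0"
      using k by (auto simp: half_nodes_def poly_prod)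
    have "(?x k has_real_derivative ?S (?x k t) t) (at t within {0..1})" if t: "t \<in> {0..1}" for t
    proof (rule has_field_derivative_transform_within[OF _ zero_less_one t])
      show "((\<lambda>_. real k - 1/2) has_real_derivative ?S (?x k t) t) (at t within {0..1})"
        using t root by (simp add: poly_rhs_half_nodes)
    qed auto
    hence "periodic_solution ?S (?x k)" by (simp add: periodic_solution_def solution_def)
    moreover have "?x k 0 \<noteq> 0"
    proof
      assume "?x k 0 = 0"
      hence "real (2 * k) = real 1" by simp
      thus False unfolding of_nat_eq_iff by presburger
    qed
    hence "\<not> (\<forall>t\<in>{0..1}. ?x k t = 0)" by (intro notI) (auto dest: bspec[of _ _ 0])
    ultimately show ?thesis
      by (simp only: nonzero_isolated_periodic_solutions_def isolated_iff_periodic mem_Collect_eq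
          restrict_extensional not_False_eq_True conj_assoc)
  qed
  hence "?x ` {1..m} \<subseteq> nonzero_isolated_periodic_solutions ?S" by blast
  moreover have "inj_on ?x {1..m}"
  proof (rule inj_onI)
    fix k l assume "?x k = ?x l"
    hence "?x k 0 = ?x l 0" by (rule arg_cong)
    thus "k = l" by simp
  qed
  ultimately have "card {1..m} \<le> card (nonzero_isolated_periodic_solutions ?S)"
    by (intro card_inj_on_le nonzero_isolated_finite)
  thus ?thesis using nonzero_isolated_card by simp
qed

theorem corollary1p6:
  fixes m :: nat
  assumes "m \<ge> 1"
  shows
    "(\<forall>(as :: nat \<Rightarrow> real \<Rightarrow> real) (a :: real \<Rightarrow> real) (b :: real \<Rightarrow> real) (lam :: nat \<Rightarrow> real).
        alternating_transversal_data m as a b lam \<longrightarrow>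
          finite (nonzero_isolated_periodic_solutions (poly_rhs m as)) \<and>
          (\<Sum>x \<in> nonzero_isolated_periodic_solutions (poly_rhs m as).
              multiplicity_of (poly_rhs m as) x) \<le> enat m) \<and>
     (\<exists>(as :: nat \<Rightarrow> real \<Rightarrow> real) (a :: real \<Rightarrow> real) (b :: real \<Rightarrow> real) (lam :: nat \<Rightarrow> real).
        alternating_transversal_data m as a b lam \<and>
          finite (nonzero_isolated_periodic_solutions (poly_rhs m as)) \<and>
          (\<Sum>x \<in> nonzero_isolated_periodic_solutions (poly_rhs m as).
              multiplicity_of (poly_rhs m as) x) = enat m)"
proof -
  \<comment> \<open>The sum of multiplicities is stated as an equality with the cardinality, since
    the sharpness example needs the exact value.\<close>
  have main: "finite (nonzero_isolated_periodic_solutions (poly_rhs m as)) \<and>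
      card (nonzero_isolated_periodic_solutions (poly_rhs m as)) \<le> m \<and>
      (\<Sum>x \<in> nonzero_isolated_periodic_solutions (poly_rhs m as). multiplicity_of (poly_rhs m as) x) =
        enat (card (nonzero_isolated_periodic_solutions (poly_rhs m as)))"
    if data: "alternating_transversal_data m as a b lam" for as a b lam
  proof -
    obtain a' b' where "alternating_data m as a b a' b' lam"
      using alternating_transversal_dataD[OF assms data] by blast
    then interpret alternating_data m as a b a' b' lam .
    show ?thesis
      using nonzero_isolated_finite nonzero_isolated_card sum_multiplicities by blast
  qed
  show ?thesis
  proof (intro conjI allI impI)
    fix as a b lam assume "alternating_transversal_data m as a b lam"
    note * = main[OF this]
    show "finite (nonzero_isolated_periodic_solutions (poly_rhs m as))" using * by blast
    show "(\<Sum>x \<in> nonzero_isolated_periodic_solutions (poly_rhs m as).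
        multiplicity_of (poly_rhs m as) x) \<le> enat m" using * by simp
  next
    show "\<exists>(as :: nat \<Rightarrow> real \<Rightarrow> real) (a :: real \<Rightarrow> real) (b :: real \<Rightarrow> real) (lam :: nat \<Rightarrow> real).
        alternating_transversal_data m as a b lam \<and>
          finite (nonzero_isolated_periodic_solutions (poly_rhs m as)) \<and>
          (\<Sum>x \<in> nonzero_isolated_periodic_solutions (poly_rhs m as).
              multiplicity_of (poly_rhs m as) x) = enat m"
      using half_nodes_data main[OF half_nodes_data] half_nodes_card[OF assms] by metis
  qed
qed

end
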